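(* Let $n\ge 1$, $q\in(0,1)$, $(a_i)_{i\in\mathbb{Z}}$ positive reals, $b_i=a_i(1-q)$, and let $P_Y(X;t)$ be the transition probability of the $n$-particle $q$-TAZRP with conductances $(a_i)$. For all $X=(x_1,\dots,x_n)\in\mathbb{W}^n$ and all $t>0$, $$P_{(0,0,\dots,0)}(X;t)=[n]_q!\,\frac{1}{W(X)}\left(\prod_{k=1}^n\frac{-1}{b_{x_k}}\right)\frac{1}{(2\pi i)^n}\oint_{C_1}dw_1\cdots\oint_{C_n}dw_n\;B(w_1,\dots,w_n)\prod_{j=1}^n\left[\,{\prod_{k=0}^{x_j}}'\left(\frac{b_{k}}{b_{k}-w_j}\right)e^{-w_jt}\right],$$ where $$B(w_1,\dots,w_n)=\prod_{1\le i<j\le n}\frac{w_i-w_j}{w_i-qw_j}.$$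
   Context: State space: $\mathbb{W}^n=\{(i_1,\dots,i_n)\in\mathbb{Z}^n: i_1\ge i_2\ge\cdots\ge i_n\}$. Process ($q$-TAZRP with inhomogeneous jump rates): $q\in(0,1)$ is fixed; each site $i\in\mathbb{Z}$ has a conductance $a_i>0$, and $b_i=a_i(1-q)$. The process is the (minimal) continuous-time Markov chain on $\mathbb{W}^n$ with the following dynamics. If $x_{k-1}>x_k=x_{k+1}=\dots=x_{k+j-1}=m>x_{k+j}$ (a stack of height $j$ at site $m$, with the inequalities involving indices $0$ or $n+1$ omitted), then the particle $x_k$ at the top of the stack jumps to $m+1$ at rate $a_m(1-q^j)=b_m(1+q+\dots+q^{j-1})$, i.e. the state changes from $X$ to $X$ with $x_k$ replaced by $x_k+1$; the other particles of the stack cannot move. No other transitions occur. $P_Y(X;t)$ is the probability that the process is in state $X$ at time $t$ given that it is in state $Y$ at time $0$. $[k]_q!=\prod_{j=1}^k\frac{1-q^j}{1-q}$. If $X=(s_1,\dots,s_1,s_2,\dots,s_2,\dots,s_m,\dots,s_m)$ with $s_1>s_2>\dots>s_m$ and $s_i$ repeated $k_i$ times, then $W(X)=\prod_{i=1}^m [k_i]_q!$. Primed product: ${\prod_{k=m}^{n}}'f(k)$ equals $\prod_{k=m}^n f(k)$ if $n\ge m$, equals $1$ if $n=m-1$, and equals $\prod_{k=n+1}^{m-1}\frac{1}{f(k)}$ if $n<m-1$. Contours: all $C_j$ are the same counter-clockwise circle $\{|z|=R\}$ with $R$ large enough to enclose all the poles $b_k$ of the integrand (e.g. $R>b_k$ for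 all $k$ between the smallest and the largest of $0,x_1,\dots,x_n$). *)

theory Defs
  imports "HOL-Complex_Analysis.Complex_Analysis" "HOL-Probability.Probability"
begin

section \<open>Minimal continuous-time Markov chains\<close>

text \<open>
  A continuous-time Markov chain is given by its jump rates: \<open>r x y\<close> is the rate of the jump
  from \<open>x\<close> to \<open>y\<close> for \<open>y \<noteq> x\<close>, with \<open>r x x = 0\<close>.
\<close>

definition total_rate :: "('s \<Rightarrow> 's \<Rightarrow> real) \<Rightarrow> 's \<Rightarrow> real" where
  "total_rate r x = (\<Sum>\<^sub>\<infinity>y. r x y)"

text \<open>
  \<open>Z\<close> is the jump chain and \<open>S\<close> the sequence of holding times of the chain with rates \<open>r\<close>
  started at \<open>y\<close>: \<open>Z\<close> is a discrete-time Markov chain with transition probabilities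
  \<open>r x x' / total_rate r x\<close>, and given \<open>Z 0, \<dots>, Z N\<close> the times \<open>S 0, \<dots>, S N\<close> are independent
  and exponential with parameters \<open>total_rate r (Z 0), \<dots>, total_rate r (Z N)\<close>. The assumption
  \<open>joint_law\<close> says both at once. No absorbing state may be reachable from \<open>y\<close>.
\<close>

locale jump_chain = prob_space M for M :: "'w measure" +
  fixes r :: "'s \<Rightarrow> 's \<Rightarrow> real" and y :: 's
    and Z :: "nat \<Rightarrow> 'w \<Rightarrow> 's" and S :: "nat \<Rightarrow> 'w \<Rightarrow> real"
  assumes measurable_Z: "\<And>i. Z i \<in> measurable M (count_space UNIV)"
    and measurable_S: "\<And>i. S i \<in> borel_measurable M"
    and joint_law: "\<And>N z s. (\<And>i. i \<le> N \<Longrightarrow> 0 \<le> s i) \<Longrightarrow>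
      \<P>(\<omega> in M. \<forall>i\<le>N. Z i \<omega> = z i \<and> s i < S i \<omega>) =
        (if z 0 = y then 1 else 0)
        * (\<Prod>i<N. r (z i) (z (Suc i)) / total_rate r (z i))
        * (\<Prod>i\<le>N. exp (- total_rate r (z i) * s i))"

definition jump_time :: "(nat \<Rightarrow> 'w \<Rightarrow> real) \<Rightarrow> nat \<Rightarrow> 'w \<Rightarrow> real" where
  "jump_time S N \<omega> = (\<Sum>i<N. S i \<omega>)"

text \<open>
  The state at time \<open>t \<ge> 0\<close> of the minimal process: it is \<open>Z N\<close> when
  \<open>jump_time S N \<le> t < jump_time S (Suc N)\<close>, and \<open>None\<close> (a cemetery) from the
  explosion time on.
\<close>

definition minimal_process ::
  "(nat \<Rightarrow> 'w \<Rightarrow> 's) \<Rightarrow> (nat \<Rightarrow> 'w \<Rightarrow> real) \<Rightarrow> real \<Rightarrow> 'w \<Rightarrow> 's option" where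
  "minimal_process Z S t \<omega> =
    (if \<exists>N. t < jump_time S (Suc N) \<omega>
     then Some (Z (LEAST N. t < jump_time S (Suc N) \<omega>) \<omega>) else None)"


section \<open>The $q$-TAZRP with inhomogeneous jump rates\<close>

text \<open>
  Configurations are lists, so the particle position \<open>x\<^sub>k\<close> (\<open>1 \<le> k \<le> n\<close>) is \<open>x ! (k - 1)\<close>.
\<close>

definition configs :: "nat \<Rightarrow> int list set" where
  "configs n = {x. length x = n \<and> sorted_wrt (\<ge>) x}"

definition top_of_stack :: "int list \<Rightarrow> nat \<Rightarrow> bool" where
  "top_of_stack x k \<longleftrightarrow> k < length x \<and> (k = 0 \<or> x ! (k - 1) > x ! k)"

text \<open>
  On \<open>configs n\<close>, \<open>count_list x (x ! k)\<close> is the height of the stack that contains the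
  particle \<open>k\<close>. Distinct \<open>k\<close> lead to distinct targets, so at most one summand is nonzero.
\<close>

definition tazrp_rate :: "real \<Rightarrow> (int \<Rightarrow> real) \<Rightarrow> int list \<Rightarrow> int list \<Rightarrow> real" where
  "tazrp_rate q a x x' =
    (\<Sum>k<length x. if top_of_stack x k \<and> x' = x[k := x ! k + 1]
       then a (x ! k) * (1 - q ^ count_list x (x ! k)) else 0)"

definition q_fact :: "real \<Rightarrow> nat \<Rightarrow> real" where
  "q_fact q k = (\<Prod>j=1..k. (1 - q ^ j) / (1 - q))"

definition stack_weight :: "real \<Rightarrow> int list \<Rightarrow> real" where
  "stack_weight q x = (\<Prod>s\<in>set x. q_fact q (count_list x s))"


section \<open>The integral formula\<close>

definition primed_prod :: "int \<Rightarrow> int \<Rightarrow> (int \<Rightarrow> complex) \<Rightarrow> complex" where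
  "primed_prod m n f =
    (if n \<ge> m then \<Prod>k\<in>{m..n}. f k
     else if n = m - 1 then 1
     else \<Prod>k\<in>{n + 1..m - 1}. 1 / f k)"

text \<open>
  The iterated integral of \<open>F [w\<^sub>1, \<dots>, w\<^sub>n]\<close> along \<open>g\<close> in each variable; the outermost
  integration is over \<open>w\<^sub>1\<close>.
\<close>

primrec iterated_contour_integral ::
  "(real \<Rightarrow> complex) \<Rightarrow> nat \<Rightarrow> (complex list \<Rightarrow> complex) \<Rightarrow> complex" where
  "iterated_contour_integral g 0 F = F []"
| "iterated_contour_integral g (Suc n) F =
    contour_integral g (\<lambda>w. iterated_contour_integral g n (\<lambda>ws. F (w # ws)))"

definition bethe_factor :: "real \<Rightarrow> complex list \<Rightarrow> complex" where
  "bethe_factor q w =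
    (\<Prod>j<length w. \<Prod>i<j. (w ! i - w ! j) / (w ! i - of_real q * w ! j))"

end

theory Submission imports Defs begin

text \<open>
  Every jump raises the sum of the positions by one, so the states reachable in \<open>k\<close> jumps form a
  finite level and the forward equations are triangular: they determine the transition probabilities
  level by level. The equations themselves come from the law of the \<open>k\<close>-th jump time: the
  probability of being in \<open>x\<close> is that of having arrived minus that of having departed, and the
  departure time is the arrival time plus an independent exponential time.

  The integral satisfies the same equations (Bethe ansatz). The one-particle factors solve a free
  evolution, under which all particles of a stack jump. When two neighbours \<open>i\<close>, \<open>i + 1\<close> share a site,
  multiplying the integrand by \<open>w\<^sub>i - q w\<^sub>i\<^sub>+\<^sub>1\<close> makes it antisymmetric in these two variables, hence the
  integral vanishes because all contours agree; so \<open>w\<^sub>i\<close> may be replaced by \<open>q w\<^sub>i\<^sub>+\<^sub>1\<close>, and the free jumps of a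
  stack of height \<open>j\<close> add up to \<open>1 + q + \<dots> + q\<^sup>j\<^sup>-\<^sup>1\<close> times the jump of one particle. The initial
  condition and the vanishing for negative positions are residue computations in the first or the last variable.
\<close>


section \<open>Integration over a torus\<close>

text \<open>Exchanging two contours needs a symmetry that an iterated integral does not display. It
  is therefore turned into an integral over a product of equal probability measures. As
  \<open>dw\<close> is \<open>2 * pi * \<i> * w\<close> times normalised arc length, every variable
  brings an extra factor \<open>w\<close>, which stays in \<open>amplitude\<close>.

  The Bethe denominators \<open>w i - q * w j\<close> with \<open>i < j\<close> treat the variables
  unequally: they have no zero when \<open>w j\<close> runs through the disc, but one inside the
  disc as functions of \<open>w i\<close>. So the last variable can be integrated by Cauchy's
  formula inside the circle, while the first one has to be treated from outside.

  A particle leaves its stack at the top but arrives at the bottom of the next one. The predecessors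
  of a state are found by lowering bottom particles, so the exit rates are written as sums over
  bottoms, too. Lowering a particle at site 0 leaves the nonnegative states; this is why the
  integral has to vanish there. The radius never changes: predecessors lie lower, so a circle that
  encloses the poles of the final state serves all of them.\<close>

definition circ :: "real \<Rightarrow> complex measure" where
  "circ R = distr (restrict_space lborel {0..1}) (restrict_space borel (sphere 0 R)) (circlepath 0 R)"

lemma circlepath_in_sphere: "0 < R \<Longrightarrow> circlepath 0 R x \<in> sphere 0 R"
  by (simp add: circlepath norm_mult)

lemma space_circ [simp]: "space (circ R) = sphere 0 R"
  by (simp add: circ_def space_restrict_space)

lemma sets_circ [measurable_cong]: "sets (circ R) = sets (restrict_space borel (sphere 0 R))"
  by (simp add: circ_def)

lemma measurable_circ: "(circ R \<rightarrow>\<^sub>M N) = (restrict_space borel (sphere 0 R) \<rightarrow>\<^sub>M N)"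
  by (rule measurable_cong_sets[OF sets_circ refl])

lemma circlepath_measurable:
  assumes "0 < R"
  shows "circlepath 0 R \<in> restrict_space lborel {0..1} \<rightarrow>\<^sub>M restrict_space borel (sphere 0 R)"
proof (rule measurable_restrict_space2)
  have "circlepath 0 R \<in> borel_measurable borel"
    unfolding circlepath by (intro borel_measurable_continuous_onI continuous_intros)
  then show "circlepath 0 R \<in> borel_measurable (restrict_space lborel {0..1})"
    by (intro measurable_restrict_space1) (simp only: measurable_lborel2)
qed (use assms circlepath_in_sphere in auto)

lemma prob_space_circ:
  assumes "0 < R"
  shows "prob_space (circ R)"
proof -
  have "prob_space (restrict_space lborel {0..1::real})"
    by (rule prob_space_restrict_space) auto
  then show ?thesis
    unfolding circ_def by (rule prob_space.prob_space_distr) (rule circlepath_measurable[OF assms])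
qed

lemma borel_measurable_circ: "f \<in> borel_measurable borel \<Longrightarrow> f \<in> borel_measurable (circ R)"
  unfolding measurable_circ by (rule measurable_restrict_space1)

lemma integral_circ:
  fixes f :: "complex \<Rightarrow> complex"
  assumes "0 < R" and f: "f \<in> borel_measurable (circ R)"
  shows "integral\<^sup>L (circ R) f = (LINT x:{0..1}|lborel. f (circlepath 0 R x))"
proof -
  have "f \<in> borel_measurable (restrict_space borel (sphere 0 R))"
    using f by (simp only: measurable_circ)
  then have "integral\<^sup>L (circ R) f = integral\<^sup>L (restrict_space lborel {0..1}) (\<lambda>x. f (circlepath 0 R x))"
    unfolding circ_def using circlepath_measurable[OF assms(1)] by (intro integral_distr)
  also have "\<dots> = (LINT x:{0..1}|lborel. f (circlepath 0 R x))"
    unfolding set_lebesgue_integral_def by (rule integral_restrict_space) simp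
  finally show ?thesis .
qed

text \<open>The derivative of \<open>circlepath 0 R\<close> is \<open>2 * pi * \<i>\<close> times
  the point itself, which produces the factor \<open>w\<close>. Measurability and a bound suffice,
  so the statement also fits functions that are themselves integrals over other variables.\<close>

lemma contour_integral_circ:
  fixes f :: "complex \<Rightarrow> complex"
  assumes R: "0 < R" and f: "f \<in> borel_measurable (circ R)"
    and bound: "\<And>w. norm w = R \<Longrightarrow> norm (f w) \<le> C"
  shows "contour_integral (circlepath 0 R) f = 2 * pi * \<i> * (\<integral>w. f w * w \<partial>circ R)"
proof -
  let ?g = "\<lambda>x. f (circlepath 0 R x) * circlepath 0 R x"
  interpret C: prob_space "circ R" by (rule prob_space_circ[OF R])
  have id: "(\<lambda>w. w) \<in> borel_measurable (circ R)"
    by (intro borel_measurable_circ) simp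
  have meas: "(\<lambda>w. f w * w) \<in> borel_measurable (circ R)"
    using f id by measurable
  have "integrable (circ R) (\<lambda>w. f w * w)"
    using meas bound R by (intro C.integrable_const_bound[where B = "C * R"])
      (auto simp: norm_mult intro!: mult_right_mono)
  then have "integrable (restrict_space lborel {0..1}) ?g"
    using integrable_distr_eq[OF circlepath_measurable[OF R], of "\<lambda>w. f w * w"] meas
    by (simp add: measurable_circ circ_def)
  then have si: "set_integrable lborel {0..1} ?g"
    unfolding set_integrable_def by (subst (asm) integrable_restrict_space) simp_all
  have "(?g has_integral (LINT x:{0..1}|lborel. ?g x)) {0..1}"
    using set_borel_integral_eq_integral[OF si] by (simp add: has_integral_iff)
  then have "(?g has_integral (\<integral>w. f w * w \<partial>circ R)) {0..1}"
    by (simp add: integral_circ[OF R meas])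
  then have "((\<lambda>x. 2 * pi * \<i> * ?g x) has_integral 2 * pi * \<i> * (\<integral>w. f w * w \<partial>circ R)) {0..1}"
    by (rule has_integral_mult_right)
  then have "(f has_contour_integral 2 * pi * \<i> * (\<integral>w. f w * w \<partial>circ R)) (circlepath 0 R)"
    unfolding has_contour_integral_def
    by (rule has_integral_eq[rotated])
      (simp add: vector_derivative_circlepath01, simp add: circlepath)
  then show ?thesis by (rule contour_integral_unique)
qed

text \<open>Cauchy's integral formula in the normalisation of \<open>circ\<close>: the factor
  \<open>w\<close> in the numerator is the density of \<open>dw\<close>.\<close>

lemma cauchy_circ:
  fixes f :: "complex \<Rightarrow> complex"
  assumes R: "0 < R" and f: "f holomorphic_on cball 0 R" and c: "norm c < R"
  shows "(\<integral>w. f w * w / (w - c) \<partial>circ R) = f c"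
proof -
  let ?h = "\<lambda>w. f w / (w - c)"
  have cont: "continuous_on (sphere 0 R) ?h"
    using f c by (intro continuous_intros continuous_on_subset[OF holomorphic_on_imp_continuous_on[OF f]])
      auto
  have "bounded (?h ` sphere 0 R)"
    by (intro compact_imp_bounded compact_continuous_image cont compact_sphere)
  then obtain C where C: "\<And>w. norm w = R \<Longrightarrow> norm (?h w) \<le> C"
    unfolding bounded_iff by (metis (no_types, lifting) imageI mem_sphere_0)
  have "?h \<in> borel_measurable (circ R)"
    using borel_measurable_continuous_on_restrict[OF cont] by (simp add: measurable_circ)
  from contour_integral_circ[OF R this C]
  have "contour_integral (circlepath 0 R) ?h = 2 * pi * \<i> * (\<integral>w. ?h w * w \<partial>circ R)" .
  moreover have "contour_integral (circlepath 0 R) ?h = 2 * pi * \<i> * f c"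
    using contour_integral_unique[OF Cauchy_integral_circlepath_simple[OF f, of c]] c by simp
  ultimately show ?thesis by simp
qed

lemma mean_value_circ:
  fixes f :: "complex \<Rightarrow> complex"
  assumes R: "0 < R" and f: "f holomorphic_on cball 0 R"
  shows "(\<integral>w. f w \<partial>circ R) = f 0"
proof -
  have "(\<integral>w. f w \<partial>circ R) = (\<integral>w. f w * w / (w - 0) \<partial>circ R)"
    using R by (intro Bochner_Integration.integral_cong) auto
  also have "\<dots> = f 0"
    by (rule cauchy_circ) (use assms in auto)
  finally show ?thesis .
qed

section \<open>Bounded measurable functions on the torus\<close>

abbreviation torus :: "real \<Rightarrow> nat \<Rightarrow> (nat \<Rightarrow> complex) measure" where
  "torus R n \<equiv> \<Pi>\<^sub>M j\<in>{..<n}. circ R"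

text \<open>Stronger than integrability, because boundedness survives products, exponentials and
  integration over one variable; on a probability space it gives integrability at once.\<close>

definition bdd_meas :: "real \<Rightarrow> nat \<Rightarrow> ((nat \<Rightarrow> complex) \<Rightarrow> complex) \<Rightarrow> bool" where
  "bdd_meas R n F \<longleftrightarrow> F \<in> borel_measurable (torus R n) \<and>
     (\<exists>C. \<forall>w\<in>space (torus R n). norm (F w) \<le> C)"

lemma space_torus: "w \<in> space (torus R n) \<longleftrightarrow> w \<in> extensional {..<n} \<and> (\<forall>j<n. norm (w j) = R)"
  by (auto simp: space_PiM PiE_def)

lemma bdd_measI:
  "F \<in> borel_measurable (torus R n) \<Longrightarrow> (\<And>w. w \<in> space (torus R n) \<Longrightarrow> norm (F w) \<le> C) \<Longrightarrow> bdd_meas R n F"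
  by (auto simp: bdd_meas_def)

lemma bdd_meas_const [intro]: "bdd_meas R n (\<lambda>_. c)"
  by (rule bdd_measI[where C = "norm c"]) auto

lemma bdd_meas_coord [intro]: "j < n \<Longrightarrow> bdd_meas R n (\<lambda>w. w j)"
proof (rule bdd_measI[where C = R])
  assume "j < n"
  then have "(\<lambda>w. w j) \<in> torus R n \<rightarrow>\<^sub>M circ R" by (intro measurable_component_singleton) simp
  from measurable_compose[OF this borel_measurable_circ, of "\<lambda>w. w"]
  show "(\<lambda>w. w j) \<in> borel_measurable (torus R n)" by simp
qed (auto simp: space_torus)

lemma bdd_meas_add [intro]: "bdd_meas R n F \<Longrightarrow> bdd_meas R n G \<Longrightarrow> bdd_meas R n (\<lambda>w. F w + G w)"
  unfolding bdd_meas_def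
proof (elim conjE exE, intro conjI exI ballI)
  fix C D w assume "\<forall>w\<in>space (torus R n). norm (F w) \<le> C" "\<forall>w\<in>space (torus R n). norm (G w) \<le> D"
    and "w \<in> space (torus R n)"
  then show "norm (F w + G w) \<le> C + D" by (intro norm_triangle_mono) auto
qed auto

lemma bdd_meas_mult [intro]: "bdd_meas R n F \<Longrightarrow> bdd_meas R n G \<Longrightarrow> bdd_meas R n (\<lambda>w. F w * G w)"
  unfolding bdd_meas_def
proof (elim conjE exE, intro conjI exI ballI)
  fix C D w assume "\<forall>w\<in>space (torus R n). norm (F w) \<le> C" "\<forall>w\<in>space (torus R n). norm (G w) \<le> D"
    and "w \<in> space (torus R n)"
  then have "norm (F w) \<le> C" "norm (G w) \<le> D" by auto
  then show "norm (F w * G w) \<le> C * D"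
    unfolding norm_mult by (intro mult_mono order_trans[OF norm_ge_zero]) auto
qed auto

lemma bdd_meas_uminus [intro]: "bdd_meas R n F \<Longrightarrow> bdd_meas R n (\<lambda>w. - F w)"
  using bdd_meas_mult[OF bdd_meas_const[of R n "-1"], of F] by simp

lemma bdd_meas_diff [intro]: "bdd_meas R n F \<Longrightarrow> bdd_meas R n G \<Longrightarrow> bdd_meas R n (\<lambda>w. F w - G w)"
  using bdd_meas_add[of R n F "\<lambda>w. - G w"] bdd_meas_uminus[of R n G] by simp

lemma bdd_meas_sum [intro]: "(\<And>i. i \<in> I \<Longrightarrow> bdd_meas R n (F i)) \<Longrightarrow> bdd_meas R n (\<lambda>w. \<Sum>i\<in>I. F i w)"
  by (induction I rule: infinite_finite_induct) auto

lemma bdd_meas_prod [intro]: "(\<And>i. i \<in> I \<Longrightarrow> bdd_meas R n (F i)) \<Longrightarrow> bdd_meas R n (\<lambda>w. \<Prod>i\<in>I. F i w)"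
  by (induction I rule: infinite_finite_induct) auto

lemma bdd_meas_inverse:
  assumes F: "bdd_meas R n F" and d: "0 < d" "\<And>w. w \<in> space (torus R n) \<Longrightarrow> d \<le> norm (F w)"
  shows "bdd_meas R n (\<lambda>w. inverse (F w))"
proof (rule bdd_measI[where C = "inverse d"])
  show "(\<lambda>w. inverse (F w)) \<in> borel_measurable (torus R n)"
    using F by (auto simp: bdd_meas_def)
  show "norm (inverse (F w)) \<le> inverse d" if "w \<in> space (torus R n)" for w
    using d(1) d(2)[OF that] by (simp add: norm_inverse le_imp_inverse_le)
qed

lemma bdd_meas_divide:
  assumes "bdd_meas R n G" "bdd_meas R n F" and "0 < d" "\<And>w. w \<in> space (torus R n) \<Longrightarrow> d \<le> norm (F w)"
  shows "bdd_meas R n (\<lambda>w. G w / F w)"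
  using bdd_meas_mult[OF assms(1) bdd_meas_inverse[OF assms(2-)]] by (simp add: divide_inverse)

lemma bdd_meas_exp [intro]:
  assumes "bdd_meas R n F"
  shows "bdd_meas R n (\<lambda>w. exp (F w))"
proof -
  obtain C where F: "F \<in> borel_measurable (torus R n)"
    and C: "\<And>w. w \<in> space (torus R n) \<Longrightarrow> norm (F w) \<le> C"
    using assms by (auto simp: bdd_meas_def)
  show ?thesis
  proof (rule bdd_measI[where C = "exp C"])
    show "(\<lambda>w. exp (F w)) \<in> borel_measurable (torus R n)"
      by (rule measurable_compose[OF F]) (intro borel_measurable_continuous_onI continuous_intros)
    show "norm (exp (F w)) \<le> exp C" if "w \<in> space (torus R n)" for w
      using norm_exp[of "F w"] C[OF that] by (meson exp_le_cancel_iff order_trans)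
  qed
qed

lemma prob_space_torus: "0 < R \<Longrightarrow> prob_space (torus R n)"
  by (intro prob_space_PiM prob_space_circ)

lemma integrable_torus:
  assumes "0 < R" "bdd_meas R n F"
  shows "integrable (torus R n) F"
proof -
  interpret prob_space "torus R n" by (rule prob_space_torus[OF assms(1)])
  obtain C where F: "F \<in> borel_measurable (torus R n)"
    and C: "\<And>w. w \<in> space (torus R n) \<Longrightarrow> norm (F w) \<le> C"
    using assms by (auto simp: bdd_meas_def)
  then show ?thesis by (intro integrable_const_bound[where B = C]) auto
qed

lemma torus_update:
  assumes "w \<in> space (torus R n)" "y \<in> sphere 0 R"
  shows "w(n := y) \<in> space (torus R (Suc n))"
  using assms by (auto simp: space_torus extensional_def)

lemma measurable_torus_update:
  "(\<lambda>(w, y). w(n := y)) \<in> torus R n \<Otimes>\<^sub>M circ R \<rightarrow>\<^sub>M torus R (Suc n)"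
  using measurable_add_dim[of n "{..<n}" "\<lambda>_. circ R"] by (simp add: lessThan_Suc)

lemma integral_torus_Suc:
  assumes "0 < R" "bdd_meas R (Suc n) F"
  shows "integral\<^sup>L (torus R (Suc n)) F = (\<integral>w. (\<integral>y. F (w(n := y)) \<partial>circ R) \<partial>torus R n)"
proof -
  interpret product_prob_space "\<lambda>_::nat. circ R" UNIV
    by (intro product_prob_spaceI prob_space_circ assms)
  have "integrable (Pi\<^sub>M (insert n {..<n}) (\<lambda>_. circ R)) F"
    using integrable_torus[OF assms] by (simp add: lessThan_Suc)
  from product_integral_insert[OF _ _ this] show ?thesis by (simp add: lessThan_Suc)
qed

lemma bdd_meas_integral:
  assumes R: "0 < R" and F: "bdd_meas R (Suc n) F"
  shows "bdd_meas R n (\<lambda>w. \<integral>y. F (w(n := y)) \<partial>circ R)"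
proof -
  obtain C where Fm: "F \<in> borel_measurable (torus R (Suc n))"
    and C: "\<And>w. w \<in> space (torus R (Suc n)) \<Longrightarrow> norm (F w) \<le> C"
    using F by (auto simp: bdd_meas_def)
  interpret C: prob_space "circ R" by (rule prob_space_circ[OF R])
  have m: "(\<lambda>(w, y). F (w(n := y))) \<in> borel_measurable (torus R n \<Otimes>\<^sub>M circ R)"
    using measurable_compose[OF measurable_torus_update Fm] by (simp add: case_prod_beta)
  show ?thesis
  proof (rule bdd_measI[where C = C])
    show "(\<lambda>w. \<integral>y. F (w(n := y)) \<partial>circ R) \<in> borel_measurable (torus R n)"
      by (rule C.borel_measurable_lebesgue_integral[OF m])
    fix w assume w: "w \<in> space (torus R n)"
    have int: "integrable (circ R) (\<lambda>y. F (w(n := y)))"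
      using measurable_Pair2[OF m w] C torus_update[OF w]
      by (intro C.integrable_const_bound[where B = C]) auto
    have "norm (\<integral>y. F (w(n := y)) \<partial>circ R) \<le> (\<integral>y. norm (F (w(n := y))) \<partial>circ R)"
      by (rule integral_norm_bound)
    also have "\<dots> \<le> (\<integral>y. C \<partial>circ R)"
      using C torus_update[OF w] int by (intro integral_mono) auto
    finally show "norm (\<integral>y. F (w(n := y)) \<partial>circ R) \<le> C" using C.prob_space by simp
  qed
qed

section \<open>Iterated contour integrals as torus integrals\<close>

text \<open>The definition peels off the outermost variable, whereas the product measure over
  \<open>{..<Suc n}\<close> arises by adding the coordinate \<open>n\<close>. Moving the recursion
  to the innermost variable aligns the two.\<close>

lemma iterated_contour_integral_snoc:
  "iterated_contour_integral g (Suc n) F =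
    iterated_contour_integral g n (\<lambda>ws. contour_integral g (\<lambda>w. F (ws @ [w])))"
proof (induction n arbitrary: F)
  case (Suc n)
  show ?case
    by (subst iterated_contour_integral.simps(2), subst Suc.IH) simp
qed simp

lemma iterated_contour_integral_cong:
  assumes "\<And>ws. length ws = n \<Longrightarrow> set ws \<subseteq> path_image g \<Longrightarrow> F ws = G ws"
  shows "iterated_contour_integral g n F = iterated_contour_integral g n G"
  using assms
proof (induction n arbitrary: F G)
  case (Suc n)
  have "iterated_contour_integral g n (\<lambda>ws. F (w # ws)) = iterated_contour_integral g n (\<lambda>ws. G (w # ws))"
    if "w \<in> path_image g" for w
    by (rule Suc.IH) (use Suc.prems that in auto)
  then show ?case by (auto intro: contour_integral_eq)
qed simp

lemma iterated_contour_integral_torus: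
  assumes R: "0 < R" and F: "bdd_meas R n (\<lambda>w. F (map w [0..<n]))"
  shows "iterated_contour_integral (circlepath 0 R) n F =
    (2 * pi * \<i>) ^ n * (\<integral>w. F (map w [0..<n]) * (\<Prod>j<n. w j) \<partial>torus R n)"
  using F
proof (induction n arbitrary: F)
  case 0
  interpret prob_space "torus R 0" by (rule prob_space_torus[OF R])
  show ?case using prob_space by simp
next
  case (Suc n)
  let ?H = "\<lambda>w. F (map w [0..<Suc n])"
  let ?K = "\<lambda>ws. 2 * pi * \<i> * (\<integral>y. F (ws @ [y]) * y \<partial>circ R)"
  have map_upd: "map (w(n := y)) [0..<Suc n] = map w [0..<n] @ [y]" for w and y :: complex
    by simp
  obtain C where Fm: "?H \<in> borel_measurable (torus R (Suc n))"
    and C: "\<And>w. w \<in> space (torus R (Suc n)) \<Longrightarrow> norm (?H w) \<le> C"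
    using Suc.prems unfolding bdd_meas_def by blast
  have m: "(\<lambda>(w, y). ?H (w(n := y))) \<in> borel_measurable (torus R n \<Otimes>\<^sub>M circ R)"
    using measurable_compose[OF measurable_torus_update Fm] by (simp only: case_prod_unfold)
  have "iterated_contour_integral (circlepath 0 R) (Suc n) F =
      iterated_contour_integral (circlepath 0 R) n (\<lambda>ws. contour_integral (circlepath 0 R) (\<lambda>w. F (ws @ [w])))"
    by (rule iterated_contour_integral_snoc)
  also have "\<dots> = iterated_contour_integral (circlepath 0 R) n ?K"
  proof (rule iterated_contour_integral_cong)
    fix ws assume ws: "length ws = n" "set ws \<subseteq> path_image (circlepath 0 R)"
    \<comment> \<open>The list becomes a point of the torus; it is restricted because points of a
      product space are extensional.\<close>
    define w where "w = (\<lambda>j\<in>{..<n}. ws ! j)"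
    have w: "w \<in> space (torus R n)"
      using ws R by (auto simp: space_torus w_def subset_iff path_image_circlepath)
    have ws_eq: "ws = map w [0..<n]"
      using ws(1) by (intro nth_equalityI) (simp_all add: w_def)
    have eq: "F (ws @ [y]) = ?H (w(n := y))" for y
      by (simp only: ws_eq map_upd)
    show "contour_integral (circlepath 0 R) (\<lambda>w. F (ws @ [w])) = ?K ws"
      unfolding eq
    proof (rule contour_integral_circ[OF R])
      show "(\<lambda>y. ?H (w(n := y))) \<in> borel_measurable (circ R)"
        using measurable_Pair2[OF m w] by simp
      show "norm (?H (w(n := y))) \<le> C" if "norm y = R" for y
        using that by (intro C torus_update w) simp
    qed
  qed
  also have "\<dots> = (2 * pi * \<i>) ^ n * (\<integral>w. ?K (map w [0..<n]) * (\<Prod>j<n. w j) \<partial>torus R n)"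
  proof (rule Suc.IH)
    have "bdd_meas R n (\<lambda>w. \<integral>y. ?H (w(n := y)) * (w(n := y)) n \<partial>circ R)"
      by (rule bdd_meas_integral[OF R]) (intro bdd_meas_mult Suc.prems bdd_meas_coord, simp)
    then have "bdd_meas R n (\<lambda>w. \<integral>y. F (map w [0..<n] @ [y]) * y \<partial>circ R)"
      by (simp only: map_upd fun_upd_same)
    then show "bdd_meas R n (\<lambda>w. ?K (map w [0..<n]))" by (intro bdd_meas_mult bdd_meas_const)
  qed
  also have "(\<integral>w. ?K (map w [0..<n]) * (\<Prod>j<n. w j) \<partial>torus R n) =
      (\<integral>w. 2 * pi * \<i> * (\<integral>y. ?H (w(n := y)) * (\<Prod>j<Suc n. (w(n := y)) j) \<partial>circ R) \<partial>torus R n)"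
  proof (intro Bochner_Integration.integral_cong refl)
    fix w
    have "(\<integral>y. ?H (w(n := y)) * (\<Prod>j<Suc n. (w(n := y)) j) \<partial>circ R)
        = (\<integral>y. F (map w [0..<n] @ [y]) * y * (\<Prod>j<n. w j) \<partial>circ R)"
      unfolding map_upd by (simp add: mult_ac)
    also have "\<dots> = (\<integral>y. F (map w [0..<n] @ [y]) * y \<partial>circ R) * (\<Prod>j<n. w j)"
      by (rule integral_mult_left_zero)
    finally show "?K (map w [0..<n]) * (\<Prod>j<n. w j) =
        2 * pi * \<i> * (\<integral>y. ?H (w(n := y)) * (\<Prod>j<Suc n. (w(n := y)) j) \<partial>circ R)"
      by (simp only: mult.assoc)
  qed
  also have "\<dots> = 2 * pi * \<i> * (\<integral>w. ?H w * (\<Prod>j<Suc n. w j) \<partial>torus R (Suc n))"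
    by (subst integral_torus_Suc[OF R])
      (intro bdd_meas_mult bdd_meas_prod Suc.prems bdd_meas_coord, simp_all)
  finally show ?case by (simp only: power_Suc2 mult.assoc)
qed

section \<open>Differentiating, permuting and slicing torus integrals\<close>

text \<open>The second-order Taylor remainder of \<open>exp\<close> is bounded uniformly on the
  torus, so the error of the difference quotient is at most linear in the increment.\<close>

lemma integral_exp_derivative:
  assumes R: "0 < R" and F: "bdd_meas R n F" and W: "bdd_meas R n W"
  shows "((\<lambda>t. \<integral>w. F w * exp (- t * W w) \<partial>torus R n) has_field_derivative
    - (\<integral>w. F w * W w * exp (- t * W w) \<partial>torus R n)) (at t)"
proof -
  interpret prob_space "torus R n" by (rule prob_space_torus[OF R])
  let ?f = "\<lambda>t. \<integral>w. F w * exp (- t * W w) \<partial>torus R n"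
  let ?D = "- (\<integral>w. F w * W w * exp (- t * W w) \<partial>torus R n)"
  have Ft: "bdd_meas R n (\<lambda>w. F w * exp (- s * W w))" for s
    by (intro bdd_meas_mult F bdd_meas_exp bdd_meas_const W)
  have FWt: "bdd_meas R n (\<lambda>w. F w * W w * exp (- t * W w))"
    by (intro bdd_meas_mult F bdd_meas_exp bdd_meas_const W)
  obtain C where C: "\<And>w. w \<in> space (torus R n) \<Longrightarrow> norm (F w * exp (- t * W w)) \<le> C"
    using Ft[of t] unfolding bdd_meas_def by blast
  obtain B where B: "\<And>w. w \<in> space (torus R n) \<Longrightarrow> norm (W w) \<le> B"
    using W unfolding bdd_meas_def by blast
  obtain w0 where "w0 \<in> space (torus R n)" using not_empty by blast
  then have C0: "0 \<le> C" and B0: "0 \<le> B" using C B norm_ge_zero order_trans by blast+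
  \<comment> \<open>\<open>C\<close> bounds the integrand at time \<open>t\<close> and
    \<open>B\<close> bounds \<open>W\<close>. For increments \<open>h\<close> with
    \<open>norm h \<le> 1\<close> the Taylor remainder of \<open>exp (- h * W w)\<close> is at most
    \<open>exp B * (norm h * B)\<^sup>2\<close>.\<close>
  define K where "K = C * (exp B * B\<^sup>2)"
  have bound: "norm ((?f s - ?f t) / (s - t) - ?D) \<le> K * norm (s - t)"
    if s: "s \<noteq> t" "norm (s - t) \<le> 1" for s
  proof -
    define h where "h = s - t"
    have h: "h \<noteq> 0" "norm h \<le> 1" using s by (auto simp: h_def)
    let ?g = "\<lambda>w. F w * exp (- s * W w) - F w * exp (- t * W w) + h * (F w * W w * exp (- t * W w))"
    have g: "bdd_meas R n ?g"
      by (intro bdd_meas_add bdd_meas_diff Ft FWt bdd_meas_mult bdd_meas_const)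
    have diff_eq: "(?f s - ?f t) - h * ?D = (\<integral>w. ?g w \<partial>torus R n)"
      using integrable_torus[OF R Ft[of s]] integrable_torus[OF R Ft[of t]] integrable_torus[OF R FWt]
      by simp
    have "norm (\<integral>w. ?g w \<partial>torus R n) \<le> (\<integral>w. norm (?g w) \<partial>torus R n)"
      by (rule integral_norm_bound)
    also have "\<dots> \<le> (\<integral>w. K * (norm h)\<^sup>2 \<partial>torus R n)"
    proof (rule integral_mono)
      fix w assume w: "w \<in> space (torus R n)"
      have g_eq: "?g w = F w * exp (- t * W w) * (exp (- h * W w) - (1 + - h * W w))"
      proof -
        have "exp (- s * W w) = exp (- t * W w) * exp (- h * W w)"
          by (simp add: h_def exp_add[symmetric] algebra_simps)
        then show ?thesis by (simp only:) (simp add: algebra_simps)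
      qed
      have "norm (F w * exp (- t * W w) * (exp (- h * W w) - (1 + - h * W w))) \<le> C * (exp B * (norm h * B)\<^sup>2)"
        unfolding norm_mult[of "F w * exp (- t * W w)"]
      proof (intro mult_mono C w)
        have hB: "norm (- h * W w) \<le> norm h * B"
          using B[OF w] by (simp add: norm_mult mult_left_mono)
        also have "norm h * B \<le> 1 * B" by (intro mult_right_mono h B0)
        finally have "norm (- h * W w) \<le> B" by simp
        then have "exp \<bar>Re (- h * W w)\<bar> \<le> exp B"
          using abs_Re_le_cmod[of "- h * W w"] by simp
        moreover have "norm (exp (- h * W w) - (1 + - h * W w)) \<le> exp \<bar>Re (- h * W w)\<bar> * (norm (- h * W w))\<^sup>2"
          using Taylor_exp[of "- h * W w" 1] by (simp add: power2_eq_square)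
        ultimately show "norm (exp (- h * W w) - (1 + - h * W w)) \<le> exp B * (norm h * B)\<^sup>2"
          using hB by (smt (verit) mult_mono exp_ge_zero norm_ge_zero power_mono zero_le_power2)
      qed (use C0 in auto)
      then show "norm (?g w) \<le> K * (norm h)\<^sup>2"
        unfolding g_eq by (simp only: K_def power_mult_distrib mult_ac)
    qed (use integrable_norm[OF integrable_torus[OF R g]] in simp_all)
    also have "\<dots> = K * (norm h)\<^sup>2" by (simp add: prob_space)
    finally have "norm ((?f s - ?f t) - h * ?D) \<le> K * (norm h)\<^sup>2"
      by (simp only: diff_eq)
    moreover have "a / h - d = (a - h * d) / h" for a d using h by (simp add: diff_divide_distrib)
    then have "(?f s - ?f t) / h - ?D = ((?f s - ?f t) - h * ?D) / h" .
    ultimately show ?thesis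
      using h unfolding h_def[symmetric] by (simp only: norm_divide) (simp add: divide_le_eq power2_eq_square mult_ac)
  qed
  have "((\<lambda>s. (?f s - ?f t) / (s - t) - ?D) \<longlongrightarrow> 0) (at t)"
  proof (rule Lim_null_comparison)
    show "\<forall>\<^sub>F s in at t. norm ((?f s - ?f t) / (s - t) - ?D) \<le> K * norm (s - t)"
      unfolding eventually_at using bound by (intro exI[of _ 1]) (auto simp: dist_norm)
    show "((\<lambda>s. K * norm (s - t)) \<longlongrightarrow> 0) (at t)"
      by (auto intro!: tendsto_eq_intros)
  qed
  then show ?thesis
    unfolding has_field_derivative_iff by (rule LIM_zero_cancel)
qed

text \<open>All coordinates carry the same measure, so relabelling them preserves the product. This
  is where the equality of the contours enters.\<close>

lemma integral_torus_permute:
  fixes \<tau> :: "nat \<Rightarrow> nat"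
  assumes R: "0 < R" and \<tau>: "bij_betw \<tau> {..<n} {..<n}" and F: "bdd_meas R n F"
  shows "(\<integral>w. F (\<lambda>j\<in>{..<n}. w (\<tau> j)) \<partial>torus R n) = (\<integral>w. F w \<partial>torus R n)"
proof -
  have "distr (torus R n) (torus R n) (\<lambda>w. \<lambda>j\<in>{..<n}. w (\<tau> j)) = torus R n"
    using \<tau> by (intro distr_PiM_reindex prob_space_circ R) (auto simp: bij_betw_def)
  then have "(\<integral>w. F w \<partial>torus R n) = (\<integral>w. F w \<partial>distr (torus R n) (torus R n) (\<lambda>w. \<lambda>j\<in>{..<n}. w (\<tau> j)))"
    by simp
  also have "\<dots> = (\<integral>w. F (\<lambda>j\<in>{..<n}. w (\<tau> j)) \<partial>torus R n)"
  proof (rule integral_distr)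
    show "(\<lambda>w. \<lambda>j\<in>{..<n}. w (\<tau> j)) \<in> torus R n \<rightarrow>\<^sub>M torus R n"
      using \<tau> by (intro measurable_restrict measurable_component_singleton) (auto simp: bij_betw_def)
    show "F \<in> borel_measurable (torus R n)" using F by (simp add: bdd_meas_def)
  qed
  finally show ?thesis ..
qed

text \<open>The recursion on tori removes the last coordinate, but the initial condition integrates
  over the first one; the others then keep their indices \<open>{1..<n}\<close>.\<close>

lemma integral_torus_first:
  assumes R: "0 < R" and n: "0 < n" and F: "bdd_meas R n F"
  shows "(\<integral>w. F w \<partial>torus R n) =
    (\<integral>w. (\<integral>y. F (w(0 := y)) \<partial>circ R) \<partial>(\<Pi>\<^sub>M j\<in>{1..<n}. circ R))"
proof -
  interpret product_prob_space "\<lambda>_::nat. circ R" UNIV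
    by (intro product_prob_spaceI prob_space_circ assms)
  have eq: "{..<n} = insert 0 {1..<n}" using n by auto
  have "integrable (Pi\<^sub>M (insert 0 {1..<n}) (\<lambda>_. circ R)) F"
    using integrable_torus[OF R F] by (simp add: eq)
  from product_integral_insert[OF _ _ this] show ?thesis by (simp add: eq)
qed


section \<open>The forward equation of a jump chain with finite levels\<close>

text \<open>The maximum covers negative thresholds, below which the exponential law has no mass; the
  tails of the chain are given for nonnegative thresholds only.\<close>

lemma emeasure_exponential_tail:
  assumes "0 < l"
  shows "emeasure (density lborel (exponential_density l)) {x<..} = ennreal (exp (- l * max x 0))"
proof -
  let ?E = "density lborel (exponential_density l)"
  interpret E: prob_space ?E by (rule prob_space_exponential_density[OF assms])
  have D: "distributed ?E lborel (\<lambda>x. x) (exponential_density l)"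
    unfolding distributed_def by (auto intro: measure_eqI simp: emeasure_distr)
  have tail: "emeasure ?E {x<..} = ennreal (exp (- l * x))" if "0 \<le> x" for x
    using E.exponential_distributedD_gt[OF D that assms]
    by (simp add: E.emeasure_eq_measure greaterThan_def mult.commute)
  show ?thesis
  proof (cases "0 \<le> x")
    case False
    have "emeasure ?E {0<..} \<le> emeasure ?E {x<..}"
      using False by (intro emeasure_mono) auto
    moreover have "emeasure ?E {x<..} \<le> 1" by (rule E.measure_le_1)
    ultimately show ?thesis using tail[of 0] False by (simp add: max_def)
  qed (simp add: tail max_def)
qed

text \<open>For fixed \<open>D\<close> the tails determine the law of \<open>V\<close>, and the
  resulting values on rectangles determine the joint law. The event \<open>E\<close> may contain
  information about the future of the chain; it only rescales by \<open>c\<close>. The clause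
  \<open>0 < V\<close> in the conclusion is due to the restriction \<open>0 \<le> s\<close> in the
  hypothesis, which leaves the nonpositive values of \<open>V\<close> open.\<close>

lemma (in prob_space) law_times_exponential:
  fixes U V :: "'a \<Rightarrow> real" and \<mu> :: "real measure" and c l :: real
  assumes [measurable]: "U \<in> borel_measurable M" "V \<in> borel_measurable M" "Measurable.pred M E"
    and \<mu>: "finite_measure \<mu>" and sets_\<mu>: "sets \<mu> = sets borel" and l: "0 < l" and c: "0 \<le> c"
    and tail: "\<And>D s. D \<in> sets borel \<Longrightarrow> 0 \<le> s \<Longrightarrow>
      prob {\<omega>\<in>space M. E \<omega> \<and> U \<omega> \<in> D \<and> s < V \<omega>} = c * measure \<mu> D * exp (- l * s)"
    and Q: "Q \<in> sets (borel \<Otimes>\<^sub>M borel)"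
  shows "prob {\<omega>\<in>space M. E \<omega> \<and> 0 < V \<omega> \<and> (U \<omega>, V \<omega>) \<in> Q} =
    c * measure (\<mu> \<Otimes>\<^sub>M density lborel (exponential_density l)) Q"
proof -
  let ?Exp = "density lborel (exponential_density l)"
  let ?A = "{\<omega>\<in>space M. E \<omega> \<and> 0 < V \<omega>}"
  define N where "N = distr (density M (indicator ?A)) (borel \<Otimes>\<^sub>M borel) (\<lambda>\<omega>. (U \<omega>, V \<omega>))"
  define \<mu>' where "\<mu>' = scale_measure (ennreal c) \<mu>"
  interpret mu: finite_measure \<mu> by fact
  interpret Exp: prob_space ?Exp by (rule prob_space_exponential_density[OF l])
  have fin': "finite_measure \<mu>'"
    by (rule finite_measureI) (simp add: \<mu>'_def mu.emeasure_eq_measure ennreal_mult_eq_top_iff)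
  interpret mu': finite_measure \<mu>' by (rule fin')
  interpret P: pair_sigma_finite \<mu> ?Exp ..
  interpret P': pair_sigma_finite \<mu>' ?Exp ..
  have N: "emeasure N X = emeasure M {\<omega>\<in>space M. E \<omega> \<and> 0 < V \<omega> \<and> (U \<omega>, V \<omega>) \<in> X}"
    if [measurable]: "X \<in> sets (borel \<Otimes>\<^sub>M borel)" for X
    unfolding N_def
    by (subst emeasure_distr) (auto simp: emeasure_restricted intro!: arg_cong[where f = "emeasure M"])
  have "\<mu>' \<Otimes>\<^sub>M ?Exp = N"
  proof (rule pair_measure_eqI)
    show "sets (\<mu>' \<Otimes>\<^sub>M ?Exp) = sets N"
      by (auto simp: N_def \<mu>'_def sets_\<mu> intro!: sets_pair_measure_cong)
    fix A B assume "A \<in> sets \<mu>'" "B \<in> sets ?Exp"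
    then have [measurable]: "A \<in> sets borel" "B \<in> sets borel"
      by (auto simp: \<mu>'_def sets_\<mu>)
    define N1 where "N1 = scale_measure (emeasure \<mu>' A) ?Exp"
    define N2 where "N2 = distr (density M (indicator {\<omega>\<in>space M. E \<omega> \<and> U \<omega> \<in> A \<and> 0 < V \<omega>})) borel V"
    have N2: "emeasure N2 X = emeasure M {\<omega>\<in>space M. E \<omega> \<and> U \<omega> \<in> A \<and> 0 < V \<omega> \<and> V \<omega> \<in> X}"
      if [measurable]: "X \<in> sets borel" for X
      unfolding N2_def
      by (subst emeasure_distr) (auto simp: emeasure_restricted intro!: arg_cong[where f = "emeasure M"])
    have N1: "emeasure N1 {x<..} = ennreal (c * measure \<mu> A * exp (- l * max x 0))" for x
      using c by (simp add: N1_def \<mu>'_def emeasure_exponential_tail[OF l] mu.emeasure_eq_measure ennreal_mult')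
    have "N1 = N2"
    proof (rule measure_eqI_lessThan)
      fix x :: real
      show "emeasure N1 {x<..} < \<infinity>" by (simp only: N1) simp
      \<comment> \<open>\<open>N2\<close> lives on \<open>0 < V\<close>, so a negative threshold can
        be raised to 0, where the hypothesis on tails applies.\<close>
      have "emeasure N2 {x<..} = emeasure M {\<omega>\<in>space M. E \<omega> \<and> U \<omega> \<in> A \<and> max x 0 < V \<omega>}"
        by (subst N2) (auto intro!: arg_cong[where f = "emeasure M"])
      also have "\<dots> = emeasure N1 {x<..}"
        using tail[of A "max x 0"] by (simp only: N1) (simp add: emeasure_eq_measure)
      finally show "emeasure N1 {x<..} = emeasure N2 {x<..}" ..
    qed (simp_all add: N1_def N2_def)
    then have "emeasure \<mu>' A * emeasure ?Exp B = emeasure N2 B"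
      by (auto simp: N1_def)
    also have "\<dots> = emeasure N (A \<times> B)"
      by (subst N2, simp, subst N, simp) (auto intro!: arg_cong[where f = "emeasure M"])
    finally show "emeasure \<mu>' A * emeasure ?Exp B = emeasure N (A \<times> B)" .
  qed (use mu'.sigma_finite_measure_axioms Exp.sigma_finite_measure_axioms in auto)
  then have "emeasure M {\<omega>\<in>space M. E \<omega> \<and> 0 < V \<omega> \<and> (U \<omega>, V \<omega>) \<in> Q} = emeasure (\<mu>' \<Otimes>\<^sub>M ?Exp) Q"
    using N[OF Q] by simp
  also have "\<dots> = (\<integral>\<^sup>+y. ennreal c * emeasure \<mu> ((\<lambda>x. (x, y)) -` Q) \<partial>?Exp)"
  proof (subst P'.emeasure_pair_measure_alt2)
    show "Q \<in> sets (\<mu>' \<Otimes>\<^sub>M ?Exp)"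
      using Q by (simp add: \<mu>'_def sets_\<mu> cong: sets_pair_measure_cong)
  qed (simp add: \<mu>'_def)
  also have "\<dots> = ennreal c * (\<integral>\<^sup>+y. emeasure \<mu> ((\<lambda>x. (x, y)) -` Q) \<partial>?Exp)"
  proof (rule nn_integral_cmult)
    show "(\<lambda>y. emeasure \<mu> ((\<lambda>x. (x, y)) -` Q)) \<in> borel_measurable ?Exp"
      by (rule P.measurable_emeasure_Pair2) (use Q in \<open>simp add: sets_\<mu> cong: sets_pair_measure_cong\<close>)
  qed
  also have "\<dots> = ennreal c * emeasure (\<mu> \<Otimes>\<^sub>M ?Exp) Q"
    by (subst P.emeasure_pair_measure_alt2) (use Q in \<open>simp_all add: sets_\<mu> cong: sets_pair_measure_cong\<close>)
  finally show ?thesis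
    using c by (simp add: measure_def enn2real_mult)
qed

lemma sets_borel_plus:
  fixes D :: "real set"
  assumes [measurable]: "D \<in> sets borel"
  shows "{(u, v). u + v \<in> D} \<in> sets (borel \<Otimes>\<^sub>M borel)"
proof -
  have "(\<lambda>p. fst p + snd p) -` D \<inter> space (borel \<Otimes>\<^sub>M borel) \<in> sets (borel \<Otimes>\<^sub>M borel)"
    by measurable
  then show ?thesis by (simp add: vimage_def case_prod_unfold space_pair_measure)
qed

text \<open>What the forward equation uses of the model: the chain is in the finite set
  \<open>L k\<close> after \<open>k\<close> jumps, and the whole rate out of a state of
  \<open>L k\<close> goes into \<open>L (Suc k)\<close>. Sums over predecessors are therefore
  finite, and positive total rates exclude absorbing states.\<close>

locale leveled_jump_chain = jump_chain M r y Z S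
  for M :: "'w measure" and r :: "'s \<Rightarrow> 's \<Rightarrow> real" and y Z S +
  fixes L :: "nat \<Rightarrow> 's set"
  assumes r_nonneg: "\<And>x x'. 0 \<le> r x x'"
    and finite_L: "\<And>k. finite (L k)"
    and L_0: "L 0 = {y}"
    and total_rate_pos: "\<And>k x. x \<in> L k \<Longrightarrow> 0 < total_rate r x"
    and sum_rates: "\<And>k x. x \<in> L k \<Longrightarrow> (\<Sum>x'\<in>L (Suc k). r x x') = total_rate r x"
begin

lemmas [measurable] = measurable_Z measurable_S

lemma pred_Z [measurable]: "Measurable.pred M (\<lambda>\<omega>. Z k \<omega> \<in> A)"
  by (rule measurable_compose[OF measurable_Z]) simp

lemma measurable_jump_time [measurable]: "jump_time S k \<in> borel_measurable M"
  unfolding jump_time_def by measurable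

lemma jump_time_Suc: "jump_time S (Suc k) \<omega> = jump_time S k \<omega> + S k \<omega>"
  by (simp add: jump_time_def)

text \<open>
  The Markov property at the \<open>k\<close>-th jump. The set \<open>D\<close> keeps track of the jump time, so that the
  step from \<open>k\<close> to \<open>k + 1\<close> only convolves with one exponential time.
\<close>

definition lawful :: "nat \<Rightarrow> bool" where
  "lawful k \<longleftrightarrow> (\<forall>N\<ge>k. \<forall>z s D. (\<forall>i\<in>{k..N}. 0 \<le> s i) \<longrightarrow> D \<in> sets borel \<longrightarrow>
    \<P>(\<omega> in M. jump_time S k \<omega> \<in> D \<and> (\<forall>i\<in>{k..N}. Z i \<omega> = z i \<and> s i < S i \<omega>)) =
    \<P>(\<omega> in M. Z k \<omega> = z k \<and> jump_time S k \<omega> \<in> D)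
      * (\<Prod>i\<in>{k..<N}. r (z i) (z (Suc i)) / total_rate r (z i))
      * (\<Prod>i\<in>{k..N}. exp (- total_rate r (z i) * s i)))"

lemma lawfulD:
  assumes "lawful k" "k \<le> N" "\<And>i. i \<in> {k..N} \<Longrightarrow> 0 \<le> s i" "D \<in> sets borel"
  shows "\<P>(\<omega> in M. jump_time S k \<omega> \<in> D \<and> (\<forall>i\<in>{k..N}. Z i \<omega> = z i \<and> s i < S i \<omega>)) =
    \<P>(\<omega> in M. Z k \<omega> = z k \<and> jump_time S k \<omega> \<in> D)
      * (\<Prod>i\<in>{k..<N}. r (z i) (z (Suc i)) / total_rate r (z i))
      * (\<Prod>i\<in>{k..N}. exp (- total_rate r (z i) * s i))"
  using assms unfolding lawful_def by blast

lemma prob_split: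
  assumes "finite F" "AE \<omega> in M. Z k \<omega> \<in> F" and [measurable]: "Measurable.pred M P"
  shows "\<P>(\<omega> in M. P \<omega>) = (\<Sum>x\<in>F. \<P>(\<omega> in M. Z k \<omega> = x \<and> P \<omega>))"
proof -
  have "\<P>(\<omega> in M. P \<omega>) = prob (\<Union>x\<in>F. {\<omega>\<in>space M. Z k \<omega> = x \<and> P \<omega>})"
    using assms(1,2) by (intro finite_measure_eq_AE sets.finite_UN) auto
  also have "\<dots> = (\<Sum>x\<in>F. \<P>(\<omega> in M. Z k \<omega> = x \<and> P \<omega>))"
    using assms(1) by (intro finite_measure_finite_Union) (auto simp: disjoint_family_on_def)
  finally show ?thesis .
qed

lemma lawful_0: "lawful 0" and AE_0: "AE \<omega> in M. Z 0 \<omega> \<in> L 0 \<and> 0 < S 0 \<omega>"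
proof -
  have "\<P>(\<omega> in M. Z 0 \<omega> = y \<and> 0 < S 0 \<omega>) = 1"
    using joint_law[of 0 "\<lambda>_. 0" "\<lambda>_. y"] by simp
  then show AE_0: "AE \<omega> in M. Z 0 \<omega> \<in> L 0 \<and> 0 < S 0 \<omega>"
    by (subst (asm) prob_Collect_eq_1) (auto simp: L_0)
  have Z0: "\<P>(\<omega> in M. Z 0 \<omega> = x \<and> jump_time S 0 \<omega> \<in> D) = (if x = y \<and> 0 \<in> D then 1 else 0)"
    if [measurable]: "D \<in> sets borel" for x D
  proof -
    have "\<P>(\<omega> in M. Z 0 \<omega> = x \<and> jump_time S 0 \<omega> \<in> D) = \<P>(\<omega> in M. x = y \<and> 0 \<in> D)"
      using AE_0 by (intro finite_measure_eq_AE) (auto simp: L_0 jump_time_def)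
    then show ?thesis by (auto simp: prob_space)
  qed
  show "lawful 0"
    unfolding lawful_def
  proof (intro allI impI)
    fix N z and s :: "nat \<Rightarrow> real" and D :: "real set"
    assume s: "\<forall>i\<in>{0..N}. 0 \<le> s i" and D: "D \<in> sets borel"
    have ball: "(\<forall>i\<in>{0..N}. P i) \<longleftrightarrow> (\<forall>i\<le>N. P i)" for P by auto
    have "\<P>(\<omega> in M. jump_time S 0 \<omega> \<in> D \<and> (\<forall>i\<in>{0..N}. Z i \<omega> = z i \<and> s i < S i \<omega>)) =
        (if 0 \<in> D then \<P>(\<omega> in M. \<forall>i\<le>N. Z i \<omega> = z i \<and> s i < S i \<omega>) else 0)"
      by (simp add: jump_time_def ball)
    then show "\<P>(\<omega> in M. jump_time S 0 \<omega> \<in> D \<and> (\<forall>i\<in>{0..N}. Z i \<omega> = z i \<and> s i < S i \<omega>)) =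
        \<P>(\<omega> in M. Z 0 \<omega> = z 0 \<and> jump_time S 0 \<omega> \<in> D)
          * (\<Prod>i\<in>{0..<N}. r (z i) (z (Suc i)) / total_rate r (z i))
          * (\<Prod>i\<in>{0..N}. exp (- total_rate r (z i) * s i))"
      using joint_law[of N s z] s Z0[OF D, of "z 0"] by (auto simp: atLeast0LessThan atLeast0AtMost)
  qed
qed

lemma prob_arrive_hold:
  assumes law: "lawful k" and [measurable]: "D \<in> sets borel" and s: "0 \<le> s"
  shows "\<P>(\<omega> in M. Z k \<omega> = x \<and> jump_time S k \<omega> \<in> D \<and> s < S k \<omega>) =
    \<P>(\<omega> in M. Z k \<omega> = x \<and> jump_time S k \<omega> \<in> D) * exp (- total_rate r x * s)"
  using lawfulD[OF law order_refl, of "\<lambda>_. s" D "\<lambda>_. x"] s by (simp add: conj_ac)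

definition arrival_law :: "nat \<Rightarrow> 's \<Rightarrow> real measure" where
  "arrival_law k x = distr (density M (indicator {\<omega>\<in>space M. Z k \<omega> = x})) borel (jump_time S k)"

lemma emeasure_arrival_law:
  assumes [measurable]: "D \<in> sets borel"
  shows "emeasure (arrival_law k x) D = ennreal (\<P>(\<omega> in M. Z k \<omega> = x \<and> jump_time S k \<omega> \<in> D))"
proof -
  have "emeasure (arrival_law k x) D = emeasure M {\<omega>\<in>space M. Z k \<omega> = x \<and> jump_time S k \<omega> \<in> D}"
    unfolding arrival_law_def
    by (subst emeasure_distr) (auto simp: emeasure_restricted intro!: arg_cong[where f = "emeasure M"])
  then show ?thesis by (simp add: emeasure_eq_measure)
qed

lemma finite_arrival_law: "finite_measure (arrival_law k x)"
proof (rule finite_measureI)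
  have "space (arrival_law k x) \<in> sets borel" by (simp add: arrival_law_def)
  then show "emeasure (arrival_law k x) (space (arrival_law k x)) \<noteq> \<infinity>"
    by (simp add: emeasure_arrival_law)
qed

text \<open>\<open>E\<close> is either the event of being in \<open>x\<close> after \<open>k\<close>
  jumps or this event joined with a future path. The convolution is the same in both cases;
  comparing them shows that, given the state, the future path is independent of the departure
  time.\<close>

lemma prob_depart:
  assumes law: "lawful k" and AE: "AE \<omega> in M. 0 < S k \<omega>" and x: "x \<in> L k"
    and [measurable]: "Measurable.pred M E" "D \<in> sets borel" and c: "0 \<le> c"
    and E: "\<And>D s. D \<in> sets borel \<Longrightarrow> 0 \<le> s \<Longrightarrow>
      \<P>(\<omega> in M. E \<omega> \<and> jump_time S k \<omega> \<in> D \<and> s < S k \<omega>) =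
      c * \<P>(\<omega> in M. Z k \<omega> = x \<and> jump_time S k \<omega> \<in> D \<and> s < S k \<omega>)"
  shows "\<P>(\<omega> in M. E \<omega> \<and> jump_time S (Suc k) \<omega> \<in> D) =
    c * measure (arrival_law k x \<Otimes>\<^sub>M density lborel (exponential_density (total_rate r x))) {(u, v). u + v \<in> D}"
proof -
  have "\<P>(\<omega> in M. E \<omega> \<and> jump_time S (Suc k) \<omega> \<in> D) =
      \<P>(\<omega> in M. E \<omega> \<and> 0 < S k \<omega> \<and> (jump_time S k \<omega>, S k \<omega>) \<in> {(u, v). u + v \<in> D})"
    using AE by (intro finite_measure_eq_AE) (auto simp: jump_time_Suc)
  also have "\<dots> = c * measure (arrival_law k x \<Otimes>\<^sub>M density lborel (exponential_density (total_rate r x)))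
      {(u, v). u + v \<in> D}"
  proof (rule law_times_exponential[OF _ _ _ finite_arrival_law _ total_rate_pos[OF x] c])
    fix B :: "real set" and s :: real assume B: "B \<in> sets borel" and s: "0 \<le> s"
    show "\<P>(\<omega> in M. E \<omega> \<and> jump_time S k \<omega> \<in> B \<and> s < S k \<omega>) =
        c * measure (arrival_law k x) B * exp (- total_rate r x * s)"
      using E[OF B s] prob_arrive_hold[OF law B s, of x]
      by (simp add: measure_def[of "arrival_law k x"] emeasure_arrival_law[OF B])
  qed (simp_all add: arrival_law_def sets_borel_plus)
  finally show ?thesis .
qed

text \<open>It serves twice: with \<open>N = Suc k\<close> and zero thresholds it yields the
  recursion for the arrivals, and with general \<open>N\<close> the Markov property at the next
  jump.\<close>

lemma lawful_Suc_aux: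
  assumes law: "lawful k" and AE: "AE \<omega> in M. Z k \<omega> \<in> L k \<and> 0 < S k \<omega>"
    and N: "Suc k \<le> N" and s: "\<And>i. i \<in> {Suc k..N} \<Longrightarrow> 0 \<le> s i" and [measurable]: "D \<in> sets borel"
  shows "\<P>(\<omega> in M. jump_time S (Suc k) \<omega> \<in> D \<and> (\<forall>i\<in>{Suc k..N}. Z i \<omega> = z i \<and> s i < S i \<omega>)) =
    (\<Sum>x\<in>L k. r x (z (Suc k)) / total_rate r x * \<P>(\<omega> in M. Z k \<omega> = x \<and> jump_time S (Suc k) \<omega> \<in> D))
      * (\<Prod>i\<in>{Suc k..<N}. r (z i) (z (Suc i)) / total_rate r (z i))
      * (\<Prod>i\<in>{Suc k..N}. exp (- total_rate r (z i) * s i))"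
proof -
  define c where "c = (\<Prod>i\<in>{Suc k..<N}. r (z i) (z (Suc i)) / total_rate r (z i))
      * (\<Prod>i\<in>{Suc k..N}. exp (- total_rate r (z i) * s i))"
  define E where "E \<omega> \<longleftrightarrow> (\<forall>i\<in>{Suc k..N}. Z i \<omega> = z i \<and> s i < S i \<omega>)" for \<omega>
  have [measurable]: "Measurable.pred M E" unfolding E_def by measurable
  have split_k: "{k..N} = insert k {Suc k..N}" "{k..<N} = insert k {Suc k..<N}" using N by auto
  have total_nonneg: "0 \<le> total_rate r x" for x
    unfolding total_rate_def by (intro infsum_nonneg r_nonneg)
  have c: "0 \<le> c"
    unfolding c_def by (intro mult_nonneg_nonneg prod_nonneg ballI divide_nonneg_nonneg r_nonneg total_nonneg) simp
  have "\<P>(\<omega> in M. jump_time S (Suc k) \<omega> \<in> D \<and> E \<omega>) =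
      (\<Sum>x\<in>L k. \<P>(\<omega> in M. Z k \<omega> = x \<and> jump_time S (Suc k) \<omega> \<in> D \<and> E \<omega>))"
    using AE by (intro prob_split finite_L) auto
  also have "\<dots> = (\<Sum>x\<in>L k. r x (z (Suc k)) / total_rate r x
      * \<P>(\<omega> in M. Z k \<omega> = x \<and> jump_time S (Suc k) \<omega> \<in> D) * c)"
  proof (intro sum.cong refl)
    fix x assume x: "x \<in> L k"
    define K where "K = measure (arrival_law k x \<Otimes>\<^sub>M density lborel (exponential_density (total_rate r x)))
      {(u, v). u + v \<in> D}"
    let ?\<rho> = "r x (z (Suc k)) / total_rate r x"
    have AE': "AE \<omega> in M. 0 < S k \<omega>" using AE by auto
    have "\<P>(\<omega> in M. (Z k \<omega> = x \<and> E \<omega>) \<and> jump_time S (Suc k) \<omega> \<in> D) = (?\<rho> * c) * K"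
      unfolding K_def
    proof (rule prob_depart[OF law AE' x])
      show "0 \<le> ?\<rho> * c" using c r_nonneg total_nonneg by simp
      fix B :: "real set" and s' :: real assume B: "B \<in> sets borel" and s': "0 \<le> s'"
      \<comment> \<open>The path is prolonged backwards by the state \<open>x\<close> and the
        threshold \<open>s'\<close> at index \<open>k\<close>. The Markov property at
        \<open>k\<close> then applies, and the additional transition splits off as the factor
        \<open>?\<rho>\<close>.\<close>
      have "\<P>(\<omega> in M. (Z k \<omega> = x \<and> E \<omega>) \<and> jump_time S k \<omega> \<in> B \<and> s' < S k \<omega>) =
          \<P>(\<omega> in M. jump_time S k \<omega> \<in> B \<and>
            (\<forall>i\<in>{k..N}. Z i \<omega> = (z(k := x)) i \<and> (s(k := s')) i < S i \<omega>))"
        by (rule arg_cong[where f = prob]) (auto simp: E_def split_k)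
      also have "\<dots> = \<P>(\<omega> in M. Z k \<omega> = x \<and> jump_time S k \<omega> \<in> B)
          * (\<Prod>i\<in>{k..<N}. r ((z(k := x)) i) ((z(k := x)) (Suc i)) / total_rate r ((z(k := x)) i))
          * (\<Prod>i\<in>{k..N}. exp (- total_rate r ((z(k := x)) i) * (s(k := s')) i))"
        using lawfulD[OF law, of N "s(k := s')" B "z(k := x)"] N s s' B by simp
      also have "(\<Prod>i\<in>{k..<N}. r ((z(k := x)) i) ((z(k := x)) (Suc i)) / total_rate r ((z(k := x)) i)) =
          ?\<rho> * (\<Prod>i\<in>{Suc k..<N}. r (z i) (z (Suc i)) / total_rate r (z i))"
        by (simp add: split_k)
      also have "(\<Prod>i\<in>{k..N}. exp (- total_rate r ((z(k := x)) i) * (s(k := s')) i)) =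
          exp (- total_rate r x * s') * (\<Prod>i\<in>{Suc k..N}. exp (- total_rate r (z i) * s i))"
        by (simp add: split_k)
      finally show "\<P>(\<omega> in M. (Z k \<omega> = x \<and> E \<omega>) \<and> jump_time S k \<omega> \<in> B \<and> s' < S k \<omega>) =
          ?\<rho> * c * \<P>(\<omega> in M. Z k \<omega> = x \<and> jump_time S k \<omega> \<in> B \<and> s' < S k \<omega>)"
        unfolding prob_arrive_hold[OF law B s'] c_def by (simp only: mult_ac)
    qed simp_all
    \<comment> \<open>The same convolution without a future event identifies \<open>K\<close> as a
      probability.\<close>
    moreover have "\<P>(\<omega> in M. Z k \<omega> = x \<and> jump_time S (Suc k) \<omega> \<in> D) = 1 * K"
      unfolding K_def by (rule prob_depart[OF law AE' x]) simp_all
    ultimately show "\<P>(\<omega> in M. Z k \<omega> = x \<and> jump_time S (Suc k) \<omega> \<in> D \<and> E \<omega>) =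
        ?\<rho> * \<P>(\<omega> in M. Z k \<omega> = x \<and> jump_time S (Suc k) \<omega> \<in> D) * c"
      by (simp add: conj_ac mult_ac)
  qed
  finally show ?thesis
    by (simp only: c_def E_def sum_distrib_right mult.assoc)
qed

lemma lawful_Suc:
  assumes law: "lawful k" and AE: "AE \<omega> in M. Z k \<omega> \<in> L k \<and> 0 < S k \<omega>"
  shows "AE \<omega> in M. Z (Suc k) \<omega> \<in> L (Suc k) \<and> 0 < S (Suc k) \<omega>"
    and "D \<in> sets borel \<Longrightarrow> \<P>(\<omega> in M. Z (Suc k) \<omega> = x' \<and> jump_time S (Suc k) \<omega> \<in> D) =
      (\<Sum>x\<in>L k. r x x' / total_rate r x * \<P>(\<omega> in M. Z k \<omega> = x \<and> jump_time S (Suc k) \<omega> \<in> D))"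
    and "lawful (Suc k)"
proof -
  have positive: "\<P>(\<omega> in M. jump_time S (Suc k) \<omega> \<in> D \<and> Z (Suc k) \<omega> = x' \<and> 0 < S (Suc k) \<omega>) =
      (\<Sum>x\<in>L k. r x x' / total_rate r x * \<P>(\<omega> in M. Z k \<omega> = x \<and> jump_time S (Suc k) \<omega> \<in> D))"
    if "D \<in> sets borel" for D x'
    using lawful_Suc_aux[OF law AE order_refl, of "\<lambda>_. 0" D "\<lambda>_. x'"] that by simp
  have "\<P>(\<omega> in M. Z (Suc k) \<omega> \<in> L (Suc k) \<and> 0 < S (Suc k) \<omega>) =
      prob (\<Union>x'\<in>L (Suc k). {\<omega>\<in>space M. jump_time S (Suc k) \<omega> \<in> UNIV \<and> Z (Suc k) \<omega> = x' \<and> 0 < S (Suc k) \<omega>})"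
    by (rule arg_cong[where f = prob]) auto
  also have "\<dots> = (\<Sum>x'\<in>L (Suc k).
      \<P>(\<omega> in M. jump_time S (Suc k) \<omega> \<in> UNIV \<and> Z (Suc k) \<omega> = x' \<and> 0 < S (Suc k) \<omega>))"
    using finite_L by (intro finite_measure_finite_Union) (auto simp: disjoint_family_on_def)
  also have "\<dots> = (\<Sum>x\<in>L k. \<Sum>x'\<in>L (Suc k). r x x' / total_rate r x * \<P>(\<omega> in M. Z k \<omega> = x))"
    by (subst positive, simp, subst sum.swap) simp
  also have "\<dots> = (\<Sum>x\<in>L k. \<P>(\<omega> in M. Z k \<omega> = x \<and> True))"
  proof (intro sum.cong refl)
    fix x assume x: "x \<in> L k"
    show "(\<Sum>x'\<in>L (Suc k). r x x' / total_rate r x * \<P>(\<omega> in M. Z k \<omega> = x)) = \<P>(\<omega> in M. Z k \<omega> = x \<and> True)"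
      using sum_rates[OF x] total_rate_pos[OF x]
      by (simp add: sum_distrib_right[symmetric] sum_divide_distrib[symmetric])
  qed
  also have "\<dots> = \<P>(\<omega> in M. True)"
    using AE by (intro prob_split[symmetric] finite_L) auto
  finally have "\<P>(\<omega> in M. Z (Suc k) \<omega> \<in> L (Suc k) \<and> 0 < S (Suc k) \<omega>) = 1"
    by (simp add: prob_space)
  then show AE': "AE \<omega> in M. Z (Suc k) \<omega> \<in> L (Suc k) \<and> 0 < S (Suc k) \<omega>"
    by (subst (asm) prob_Collect_eq_1) auto
  show step: "\<P>(\<omega> in M. Z (Suc k) \<omega> = x' \<and> jump_time S (Suc k) \<omega> \<in> D) =
      (\<Sum>x\<in>L k. r x x' / total_rate r x * \<P>(\<omega> in M. Z k \<omega> = x \<and> jump_time S (Suc k) \<omega> \<in> D))"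
    if [measurable]: "D \<in> sets borel" for D x'
  proof -
    have "\<P>(\<omega> in M. Z (Suc k) \<omega> = x' \<and> jump_time S (Suc k) \<omega> \<in> D) =
        \<P>(\<omega> in M. jump_time S (Suc k) \<omega> \<in> D \<and> Z (Suc k) \<omega> = x' \<and> 0 < S (Suc k) \<omega>)"
      using AE' by (intro finite_measure_eq_AE) auto
    then show ?thesis using positive[OF that] by simp
  qed
  show "lawful (Suc k)"
    unfolding lawful_def
    using lawful_Suc_aux[OF law AE] step by simp
qed

lemma lawful: "lawful k" and AE_level: "AE \<omega> in M. Z k \<omega> \<in> L k \<and> 0 < S k \<omega>"
proof (induction k)
  case 0
  show "lawful 0" "AE \<omega> in M. Z 0 \<omega> \<in> L 0 \<and> 0 < S 0 \<omega>" by (fact lawful_0 AE_0)+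
next
  case (Suc k)
  show "lawful (Suc k)" "AE \<omega> in M. Z (Suc k) \<omega> \<in> L (Suc k) \<and> 0 < S (Suc k) \<omega>"
    by (fact lawful_Suc(3)[OF Suc.IH] lawful_Suc(1)[OF Suc.IH])+
qed

lemma AE_levels: "AE \<omega> in M. \<forall>k. Z k \<omega> \<in> L k \<and> 0 < S k \<omega>"
  unfolding AE_all_countable using AE_level by blast

lemma jump_time_mono:
  assumes "\<And>k. 0 < S k \<omega>" "i \<le> j"
  shows "jump_time S i \<omega> \<le> jump_time S j \<omega>"
  unfolding jump_time_def using assms by (intro sum_mono2) (auto intro: less_imp_le)

section \<open>Arrival, departure and occupation probabilities\<close>

definition arrived :: "nat \<Rightarrow> 's \<Rightarrow> real \<Rightarrow> real" where
  "arrived k x t = \<P>(\<omega> in M. Z k \<omega> = x \<and> jump_time S k \<omega> \<le> t)"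

definition departed :: "nat \<Rightarrow> 's \<Rightarrow> real \<Rightarrow> real" where
  "departed k x t = \<P>(\<omega> in M. Z k \<omega> = x \<and> jump_time S (Suc k) \<omega> \<le> t)"

definition occupied :: "nat \<Rightarrow> 's \<Rightarrow> real \<Rightarrow> real" where
  "occupied k x t = \<P>(\<omega> in M. Z k \<omega> = x \<and> jump_time S k \<omega> \<le> t \<and> t < jump_time S (Suc k) \<omega>)"

lemma occupied_eq: "occupied k x t = arrived k x t - departed k x t"
proof -
  have "departed k x t = \<P>(\<omega> in M. Z k \<omega> = x \<and> jump_time S k \<omega> \<le> t \<and> jump_time S (Suc k) \<omega> \<le> t)"
    unfolding departed_def using AE_level[of k]
    by (intro finite_measure_eq_AE) (auto simp: jump_time_Suc)
  then have "occupied k x t + departed k x t =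
      prob ({\<omega>\<in>space M. Z k \<omega> = x \<and> jump_time S k \<omega> \<le> t \<and> t < jump_time S (Suc k) \<omega>} \<union>
        {\<omega>\<in>space M. Z k \<omega> = x \<and> jump_time S k \<omega> \<le> t \<and> jump_time S (Suc k) \<omega> \<le> t})"
    unfolding occupied_def by (subst finite_measure_Union) auto
  also have "\<dots> = arrived k x t"
    unfolding arrived_def by (rule arg_cong[where f = prob]) auto
  finally show ?thesis by simp
qed

lemma arrived_0: "0 \<le> t \<Longrightarrow> arrived 0 x t = (if x = y then 1 else 0)"
proof -
  assume t: "0 \<le> t"
  have "arrived 0 x t = \<P>(\<omega> in M. x = y)"
    unfolding arrived_def using AE_level[of 0] t
    by (intro finite_measure_eq_AE) (auto simp: L_0 jump_time_def)
  then show ?thesis by (simp add: prob_space)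
qed

lemma arrived_Suc: "arrived (Suc k) x' t = (\<Sum>x\<in>L k. r x x' / total_rate r x * departed k x t)"
  unfolding arrived_def departed_def
  using lawful_Suc(2)[OF lawful AE_level, where D = "{..t}"] by simp

lemma arrived_neg: "t < 0 \<Longrightarrow> arrived k x t = 0"
proof -
  assume t: "t < 0"
  have "arrived k x t = \<P>(\<omega> in M. False)"
    unfolding arrived_def
  proof (intro finite_measure_eq_AE)
    show "AE \<omega> in M. \<omega> \<in> {\<omega>\<in>space M. Z k \<omega> = x \<and> jump_time S k \<omega> \<le> t} \<longleftrightarrow> \<omega> \<in> {\<omega>\<in>space M. False}"
      using AE_levels
    proof eventually_elim
      case (elim \<omega>)
      then show ?case using jump_time_mono[of \<omega> 0 k] t by (simp add: jump_time_def)
    qed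
  qed auto
  then show ?thesis by simp
qed

lemma occupied_outside:
  assumes "x \<notin> L k"
  shows "occupied k x t = 0"
proof -
  have "occupied k x t = \<P>(\<omega> in M. False)"
    unfolding occupied_def using AE_level[of k] assms by (intro finite_measure_eq_AE) auto
  then show ?thesis by simp
qed

lemma occupied_start: "occupied k x 0 = (if k = 0 \<and> x = y then 1 else 0)"
proof -
  have "occupied k x 0 = \<P>(\<omega> in M. k = 0 \<and> x = y)"
    unfolding occupied_def
  proof (intro finite_measure_eq_AE)
    show "AE \<omega> in M. \<omega> \<in> {\<omega>\<in>space M. Z k \<omega> = x \<and> jump_time S k \<omega> \<le> 0 \<and> 0 < jump_time S (Suc k) \<omega>}
        \<longleftrightarrow> \<omega> \<in> {\<omega>\<in>space M. k = 0 \<and> x = y}"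
      using AE_levels AE_space
    proof eventually_elim
      case (elim \<omega>)
      have start: "Z 0 \<omega> = y" "0 < S 0 \<omega>" using elim L_0 by auto
      show ?case
      proof (cases k)
        case (Suc j)
        then have "S 0 \<omega> \<le> jump_time S k \<omega>"
          using jump_time_mono[of \<omega> "Suc 0" k] elim by (simp add: jump_time_def)
        then show ?thesis using start Suc by simp
      qed (use start elim in \<open>auto simp: jump_time_def\<close>)
    qed
  qed auto
  then show ?thesis by (simp add: prob_space)
qed

text \<open>As \<open>X\<close> lies in no level other than that of \<open>k\<close>, the chain can
  only be in \<open>X\<close> after exactly \<open>k\<close> jumps, which pins down the least index
  in \<open>minimal_process\<close>.\<close>

lemma prob_minimal_process:
  assumes t: "0 \<le> t" and X: "\<And>j. j \<noteq> k \<Longrightarrow> X \<notin> L j"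
  shows "\<P>(\<omega> in M. minimal_process Z S t \<omega> = Some X) = occupied k X t"
proof -
  have eq: "minimal_process Z S t \<omega> = Some X \<longleftrightarrow>
      (\<exists>N. Z N \<omega> = X \<and> t < jump_time S (Suc N) \<omega> \<and> (\<forall>i<N. jump_time S (Suc i) \<omega> \<le> t))" for \<omega>
  proof
    assume "minimal_process Z S t \<omega> = Some X"
    then have "\<exists>N. t < jump_time S (Suc N) \<omega>" and "Z (LEAST N. t < jump_time S (Suc N) \<omega>) \<omega> = X"
      by (auto simp: minimal_process_def split: if_splits)
    then show "\<exists>N. Z N \<omega> = X \<and> t < jump_time S (Suc N) \<omega> \<and> (\<forall>i<N. jump_time S (Suc i) \<omega> \<le> t)"
      by (metis (mono_tags, lifting) LeastI_ex not_less_Least linorder_not_less)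
  next
    assume "\<exists>N. Z N \<omega> = X \<and> t < jump_time S (Suc N) \<omega> \<and> (\<forall>i<N. jump_time S (Suc i) \<omega> \<le> t)"
    then obtain N where N: "Z N \<omega> = X" "t < jump_time S (Suc N) \<omega>" "\<forall>i<N. jump_time S (Suc i) \<omega> \<le> t"
      by blast
    then have "(LEAST N. t < jump_time S (Suc N) \<omega>) = N"
      by (intro Least_equality) (auto simp: not_less[symmetric])
    with N show "minimal_process Z S t \<omega> = Some X" by (auto simp: minimal_process_def)
  qed
  show ?thesis
    unfolding occupied_def eq
  proof (intro finite_measure_eq_AE)
    show "AE \<omega> in M. \<omega> \<in> {\<omega>\<in>space M. \<exists>N. Z N \<omega> = X \<and> t < jump_time S (Suc N) \<omega> \<and> (\<forall>i<N. jump_time S (Suc i) \<omega> \<le> t)}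
        \<longleftrightarrow> \<omega> \<in> {\<omega>\<in>space M. Z k \<omega> = X \<and> jump_time S k \<omega> \<le> t \<and> t < jump_time S (Suc k) \<omega>}"
      using AE_levels
    proof eventually_elim
      case (elim \<omega>)
      have "N = k" if "Z N \<omega> = X" for N using elim X that by metis
      moreover have "(\<forall>i<k. jump_time S (Suc i) \<omega> \<le> t) \<longleftrightarrow> jump_time S k \<omega> \<le> t"
      proof
        assume "\<forall>i<k. jump_time S (Suc i) \<omega> \<le> t"
        then show "jump_time S k \<omega> \<le> t" using t by (cases k) (auto simp: jump_time_def)
      next
        assume "jump_time S k \<omega> \<le> t"
        then show "\<forall>i<k. jump_time S (Suc i) \<omega> \<le> t"
          using jump_time_mono[of \<omega> _ k] elim by (meson Suc_leI order_trans)
      qed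
      ultimately show ?case by auto
    qed
  qed simp_all
qed

text \<open>The convolution of \<open>arrived\<close> with the exponential density. With
  \<open>exp (- total_rate r x * T)\<close> pulled out, \<open>T\<close> occurs in the integral only
  as its upper limit, so the fundamental theorem of calculus applies.\<close>

lemma departed_integral:
  assumes x: "x \<in> L k" and T: "0 \<le> T" and cont: "continuous_on {0..T} (arrived k x)"
  shows "departed k x T = exp (- total_rate r x * T) *
    integral {0..T} (\<lambda>u. total_rate r x * exp (total_rate r x * u) * arrived k x u)"
proof -
  define l where "l = total_rate r x"
  have l: "0 < l" using total_rate_pos[OF x] by (simp add: l_def)
  let ?Exp = "density lborel (exponential_density l)"
  interpret A: finite_measure "arrival_law k x" by (rule finite_arrival_law)
  interpret Exp: prob_space ?Exp by (rule prob_space_exponential_density[OF l])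
  interpret P: pair_sigma_finite "arrival_law k x" ?Exp ..
  interpret P: finite_measure "arrival_law k x \<Otimes>\<^sub>M ?Exp"
    by (intro finite_measure_pair_measure A.finite_measure_axioms Exp.finite_measure_axioms)
  define g where "g u = l * exp (l * u) * arrived k x u" for u
  define f where "f u = exp (- l * T) * (g u * indicator {0..T} u)" for u
  have cont_g: "continuous_on {0..T} g"
    unfolding g_def by (intro continuous_intros cont)
  have g_int: "(g has_integral integral {0..T} g) {0..T}"
    using cont_g by (intro integrable_integral integrable_continuous_interval)
  have "(\<lambda>u. indicator {0..T} u *\<^sub>R g u) \<in> borel_measurable borel"
    by (rule borel_measurable_continuous_on_indicator[OF _ cont_g]) simp
  then have f_meas: "f \<in> borel_measurable borel"
    unfolding f_def by (simp add: mult.commute)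
  have f_nonneg: "0 \<le> f u" for u
    using l by (simp add: f_def g_def arrived_def indicator_def)
  have mono: "mono (arrived k x)"
    unfolding arrived_def by (intro monoI finite_measure_mono) auto
  have [measurable]: "arrived k x \<in> borel_measurable borel"
    by (rule borel_measurable_mono[OF mono])
  have Q: "{(u, v). u + v \<in> {..T}} \<in> sets (borel \<Otimes>\<^sub>M borel)"
    by (rule sets_borel_plus) simp
  have "departed k x T = measure (arrival_law k x \<Otimes>\<^sub>M ?Exp) {(u, v). u + v \<in> {..T}}"
    using prob_depart[OF lawful _ x, of "\<lambda>\<omega>. Z k \<omega> = x" "{..T}" 1] AE_level[of k]
    by (simp add: departed_def l_def)
  then have "ennreal (departed k x T) = emeasure (arrival_law k x \<Otimes>\<^sub>M ?Exp) {(u, v). u + v \<in> {..T}}"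
    by (simp add: P.emeasure_eq_measure)
  also have "\<dots> = (\<integral>\<^sup>+v. ennreal (arrived k x (T - v)) \<partial>?Exp)"
  proof (subst P.emeasure_pair_measure_alt2)
    show "{(u, v). u + v \<in> {..T}} \<in> sets (arrival_law k x \<Otimes>\<^sub>M ?Exp)"
      using Q by (simp add: arrival_law_def cong: sets_pair_measure_cong)
    have "(\<lambda>u. (u, v)) -` {(u, v). u + v \<in> {..T}} = {..T - v}" for v by auto
    then show "(\<integral>\<^sup>+v. emeasure (arrival_law k x) ((\<lambda>u. (u, v)) -` {(u, v). u + v \<in> {..T}}) \<partial>?Exp) =
        (\<integral>\<^sup>+v. ennreal (arrived k x (T - v)) \<partial>?Exp)"
      by (simp add: emeasure_arrival_law arrived_def)
  qed
  also have "\<dots> = (\<integral>\<^sup>+v. ennreal (exponential_density l v) * ennreal (arrived k x (T - v)) \<partial>lborel)"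
    by (rule nn_integral_density) simp_all
  \<comment> \<open>The substitution \<open>v = T - u\<close> makes the argument of
    \<open>arrived\<close> the integration variable.\<close>
  also have "\<dots> = ennreal \<bar>-1\<bar> * (\<integral>\<^sup>+u. ennreal (exponential_density l (T + (- 1) * u)) *
      ennreal (arrived k x (T - (T + (- 1) * u))) \<partial>lborel)"
    by (rule nn_integral_real_affine) simp_all
  also have "\<dots> = (\<integral>\<^sup>+u. ennreal (f u) \<partial>lborel)"
  proof -
    have "ennreal (exponential_density l (T - u)) * ennreal (arrived k x u) = ennreal (f u)" for u
    proof (cases "u < 0")
      case False
      have "exponential_density l (T - u) * arrived k x u = f u"
        using False by (auto simp: exponential_density_def f_def g_def exp_diff exp_minus field_simps)
      then show ?thesis using l
        by (simp add: ennreal_mult[symmetric] arrived_def exponential_density_nonneg)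
    qed (simp add: arrived_neg f_def)
    then show ?thesis by simp
  qed
  also have "\<dots> = ennreal (exp (- l * T) * integral {0..T} g)"
  proof (rule nn_integral_has_integral_lborel[OF f_meas f_nonneg])
    have "((\<lambda>u. if u \<in> {0..T} then g u else 0) has_integral integral {0..T} g) UNIV"
      by (subst has_integral_restrict_UNIV) (rule g_int)
    then have "((\<lambda>u. exp (- l * T) * (if u \<in> {0..T} then g u else 0)) has_integral
        exp (- l * T) * integral {0..T} g) UNIV"
      by (rule has_integral_mult_right)
    then show "(f has_integral exp (- l * T) * integral {0..T} g) UNIV"
      by (rule has_integral_eq[rotated]) (simp add: f_def)
  qed
  finally have "ennreal (departed k x T) = ennreal (exp (- l * T) * integral {0..T} g)" .
  moreover have "0 \<le> integral {0..T} g"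
    using l by (intro integral_nonneg integrable_continuous_interval cont_g) (simp add: g_def arrived_def)
  moreover have "0 \<le> departed k x T" by (simp add: departed_def)
  ultimately show ?thesis
    by (simp add: g_def[abs_def] l_def)
qed

text \<open>With \<open>l\<close> the total rate, the product rule gives
  \<open>l * arrived - l * departed\<close>, which is \<open>l * occupied\<close>.\<close>

lemma departed_derivative:
  assumes x: "x \<in> L k" and T: "0 \<le> T" and cont: "continuous_on {0..T} (arrived k x)" and t: "t \<in> {0..T}"
  shows "(departed k x has_real_derivative total_rate r x * occupied k x t) (at t within {0..T})"
proof -
  let ?l = "total_rate r x"
  let ?g = "\<lambda>u. ?l * exp (?l * u) * arrived k x u"
  have "((\<lambda>t. exp (- ?l * t) * integral {0..t} ?g) has_real_derivative
      (exp (- ?l * t) * (- ?l)) * integral {0..t} ?g + exp (- ?l * t) * ?g t) (at t within {0..T})"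
  proof -
    have "((\<lambda>t. integral {0..t} ?g) has_real_derivative ?g t) (at t within {0..T})"
      by (rule integral_has_real_derivative[OF _ t]) (intro continuous_intros cont)
    moreover have "((\<lambda>t. exp (- ?l * t)) has_real_derivative exp (- ?l * t) * (- ?l)) (at t within {0..T})"
      by (auto intro!: derivative_eq_intros)
    ultimately show ?thesis
      by (auto intro!: derivative_eq_intros)
  qed
  moreover have dep: "departed k x s = exp (- ?l * s) * integral {0..s} ?g" if "s \<in> {0..T}" for s
    using that by (intro departed_integral x continuous_on_subset[OF cont]) auto
  moreover have "exp (- ?l * t) * (- ?l) * integral {0..t} ?g + exp (- ?l * t) * ?g t = ?l * occupied k x t"
  proof -
    have "exp (- ?l * t) * ?g t = ?l * arrived k x t"
      by (simp add: exp_minus)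
    then show ?thesis
      by (simp add: occupied_eq dep[OF t] algebra_simps)
  qed
  ultimately show ?thesis
    using t by (subst has_field_derivative_cong_eventually[where g = "\<lambda>t. exp (- ?l * t) * integral {0..t} ?g"])
      (auto simp: eventually_at_filter)
qed

text \<open>Continuity climbs the levels: if \<open>arrived\<close> is continuous,
  \<open>departed\<close> is differentiable, and the arrivals one level higher are finite sums of
  departures.\<close>

lemma continuous_on_arrived: "0 \<le> T \<Longrightarrow> continuous_on {0..T} (arrived k x)"
proof (induction k arbitrary: x)
  case 0
  then have "continuous_on {0..T} (arrived 0 x) \<longleftrightarrow> continuous_on {0..T} (\<lambda>_. if x = y then 1 else 0 :: real)"
    by (intro continuous_on_cong) (auto simp: arrived_0)
  then show ?case by simp
next
  case (Suc k)
  have "continuous_on {0..T} (departed k x')" if "x' \<in> L k" for x'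
    unfolding continuous_on_eq_continuous_within
    using departed_derivative[OF that Suc.prems Suc.IH[OF Suc.prems]] DERIV_continuous by blast
  then show ?case
    unfolding arrived_Suc[abs_def] by (intro continuous_intros) auto
qed

text \<open>Arrivals from the level below minus departures at the total rate. The derivative is
  taken within \<open>{0..T}\<close> because it is one-sided at time 0.\<close>

theorem forward_equation:
  assumes x: "x \<in> L k" and t: "t \<in> {0..T}"
  shows "(occupied k x has_real_derivative
    (case k of 0 \<Rightarrow> 0 | Suc j \<Rightarrow> \<Sum>x'\<in>L j. r x' x * occupied j x' t) - total_rate r x * occupied k x t)
    (at t within {0..T})"
proof -
  have T: "0 \<le> T" using t by simp
  have "(arrived k x has_real_derivative
      (case k of 0 \<Rightarrow> 0 | Suc j \<Rightarrow> \<Sum>x'\<in>L j. r x' x * occupied j x' t)) (at t within {0..T})"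
  proof (cases k)
    case 0
    have "((\<lambda>_. if x = y then 1 else 0) has_real_derivative 0) (at t within {0..T})" by simp
    then show ?thesis
      using t 0 by (subst has_field_derivative_cong_eventually[where g = "\<lambda>_. if x = y then 1 else 0"])
        (auto simp: eventually_at_filter arrived_0)
  next
    case (Suc j)
    have "(arrived k x has_real_derivative
        (\<Sum>x'\<in>L j. r x' x / total_rate r x' * (total_rate r x' * occupied j x' t))) (at t within {0..T})"
      unfolding Suc arrived_Suc[abs_def]
      by (intro DERIV_sum DERIV_cmult departed_derivative[OF _ T continuous_on_arrived[OF T] t])
    also have "(\<Sum>x'\<in>L j. r x' x / total_rate r x' * (total_rate r x' * occupied j x' t)) =
        (\<Sum>x'\<in>L j. r x' x * occupied j x' t)"
      using total_rate_pos by (intro sum.cong) (auto simp: less_imp_neq[symmetric])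
    finally show ?thesis by (simp add: Suc)
  qed
  from DERIV_diff[OF this departed_derivative[OF x T continuous_on_arrived[OF T] t]]
  show ?thesis by (simp add: occupied_eq[abs_def])
qed

end


section \<open>The Bethe ansatz\<close>

text \<open>The counterpart of \<open>bethe_factor\<close> for points of the torus, whose
  coordinates can be updated and permuted.\<close>

definition bethe :: "real \<Rightarrow> nat \<Rightarrow> (nat \<Rightarrow> complex) \<Rightarrow> complex" where
  "bethe q n w = (\<Prod>j<n. \<Prod>i<j. (w i - w j) / (w i - of_real q * w j))"

lemma bethe_factor_map: "bethe_factor q (map w [0..<n]) = bethe q n w"
  by (simp add: bethe_factor_def bethe_def)

lemma bethe_cong: "(\<And>j. j < n \<Longrightarrow> w j = v j) \<Longrightarrow> bethe q n w = bethe q n v"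
  by (simp add: bethe_def)

lemma bethe_Suc: "bethe q (Suc n) w = bethe q n w * (\<Prod>i<n. (w i - w n) / (w i - of_real q * w n))"
  by (simp add: bethe_def)

lemma bethe_split_first:
  assumes "0 < n"
  shows "bethe q n w = (\<Prod>j\<in>{1..<n}. (w 0 - w j) / (w 0 - of_real q * w j)) *
    (\<Prod>j\<in>{1..<n}. \<Prod>i\<in>{1..<j}. (w i - w j) / (w i - of_real q * w j))"
proof -
  have n: "{..<n} = insert 0 {1..<n}" using assms by auto
  have j: "{..<j} = insert 0 {1..<j}" if "j \<in> {1..<n}" for j using that by auto
  have "bethe q n w = (\<Prod>j\<in>{1..<n}. \<Prod>i<j. (w i - w j) / (w i - of_real q * w j))"
    by (simp add: bethe_def n)
  also have "\<dots> = (\<Prod>j\<in>{1..<n}. (w 0 - w j) / (w 0 - of_real q * w j) *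
      (\<Prod>i\<in>{1..<j}. (w i - w j) / (w i - of_real q * w j)))"
    by (intro prod.cong refl) (simp add: j)
  finally show ?thesis by (simp only: prod.distrib)
qed

text \<open>Since \<open>i\<close> and \<open>Suc i\<close> are adjacent, the transposition permutes
  all other pairs of indices and keeps their order. Only the factor of the pair itself changes; the
  prefactor cancels its denominator and leaves the antisymmetric
  \<open>w i - w (Suc i)\<close>.\<close>

lemma bethe_transpose:
  fixes w v :: "nat \<Rightarrow> complex"
  assumes i: "Suc i < n" and v: "\<And>j. j < n \<Longrightarrow> v j = w (Transposition.transpose i (Suc i) j)"
    and ne: "w i \<noteq> of_real q * w (Suc i)" "w (Suc i) \<noteq> of_real q * w i"
  shows "(v i - of_real q * v (Suc i)) * bethe q n v = - ((w i - of_real q * w (Suc i)) * bethe q n w)"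
proof -
  let ?\<tau> = "Transposition.transpose i (Suc i)"
  define g where "g u k l = (u k - u l) / (u k - of_real q * u l)" for u :: "nat \<Rightarrow> complex" and k l
  define D where "D = (SIGMA l:{..<n}. {..<l}) - {(Suc i, i)}"
  have split: "bethe q n u = g u i (Suc i) * (\<Prod>(l, k)\<in>D. g u k l)" for u
  proof -
    have "bethe q n u = (\<Prod>(l, k)\<in>(SIGMA l:{..<n}. {..<l}). g u k l)"
      by (simp add: bethe_def g_def prod.Sigma)
    also have "(SIGMA l:{..<n}. {..<l}) = insert (Suc i, i) D" using i by (auto simp: D_def)
    finally have "bethe q n u = (\<Prod>(l, k)\<in>insert (Suc i, i) D. g u k l)" .
    moreover have "finite D" "(Suc i, i) \<notin> D" by (simp_all add: D_def)
    ultimately show ?thesis by simp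
  qed
  have "(\<Prod>(l, k)\<in>D. g v k l) = (\<Prod>p\<in>D. (\<lambda>(l, k). g w k l) (map_prod ?\<tau> ?\<tau> p))"
    using v by (intro prod.cong) (auto simp: D_def g_def)
  also have "\<dots> = (\<Prod>(l, k)\<in>D. g w k l)"
  proof (rule prod.reindex_bij_betw, rule bij_betw_byWitness[where f' = "map_prod ?\<tau> ?\<tau>"])
    have "map_prod ?\<tau> ?\<tau> (l, k) \<in> D" if "(l, k) \<in> D" for l k
      using that i by (auto simp: D_def Transposition.transpose_def)
    then show "map_prod ?\<tau> ?\<tau> ` D \<subseteq> D" "map_prod ?\<tau> ?\<tau> ` D \<subseteq> D" by auto
  qed auto
  finally have D_eq: "(\<Prod>(l, k)\<in>D. g v k l) = (\<Prod>(l, k)\<in>D. g w k l)" .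
  have "v i = w (Suc i)" "v (Suc i) = w i" using v i by auto
  then show ?thesis
    unfolding split D_eq using ne by (simp add: g_def divide_simps) (simp add: algebra_simps)
qed

section \<open>Bounds on the circle and one-particle eigenfunctions\<close>

locale bethe_ansatz =
  fixes q R :: real and b :: "int \<Rightarrow> real"
  assumes q_pos: "0 < q" and q_less: "q < 1" and R_pos: "0 < R" and b_pos: "\<And>i. 0 < b i"
begin

text \<open>The second point may lie anywhere in the closed disc. The bound thus controls the Bethe
  factor on the torus and also excludes its poles while the last variable moves inwards.\<close>

lemma circle_gap:
  assumes "norm (u::complex) = R" "norm v \<le> R"
  shows "R * (1 - q) \<le> norm (u - of_real q * v)"
proof -
  have "norm u - norm (of_real q * v) \<le> norm (u - of_real q * v)" by (rule norm_triangle_ineq2)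
  moreover have "norm (of_real q * v) \<le> q * R"
    using assms q_pos by (simp add: norm_mult)
  ultimately show ?thesis using assms by (simp add: algebra_simps)
qed

lemma circle_ne:
  assumes "norm (u::complex) = R" "norm v \<le> R"
  shows "u - of_real q * v \<noteq> 0"
  using circle_gap[OF assms] R_pos q_less by (auto simp: mult_le_0_iff)

lemma bdd_meas_bethe: "bdd_meas R n (bethe q n)"
  unfolding bethe_def
proof (intro bdd_meas_prod bdd_meas_divide)
  fix i j assume ij: "j \<in> {..<n}" "i \<in> {..<j}"
  show "0 < R * (1 - q)" using R_pos q_less by simp
  show "R * (1 - q) \<le> norm (w i - of_real q * w j)" if "w \<in> space (torus R n)" for w
    using that ij by (intro circle_gap) (auto simp: space_torus)
qed (intro bdd_meas_diff bdd_meas_mult bdd_meas_const bdd_meas_coord; simp)+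

text \<open>The eigenfunction of the free evolution of one particle, with the factor \<open>-1/b\<^sub>x\<close> of the formula absorbed.\<close>

definition psi :: "int \<Rightarrow> complex \<Rightarrow> complex" where
  "psi x w = - primed_prod 0 x (\<lambda>k. of_real (b k) / (of_real (b k) - w)) / of_real (b x)"

text \<open>The sites from 0 to \<open>x\<close> give the poles of \<open>psi x\<close>. For
  negative \<open>x\<close> the condition is vacuous, as \<open>psi x\<close> is then a polynomial.
  Lowering a particle preserves it.\<close>

definition enclosed :: "int \<Rightarrow> bool" where
  "enclosed x \<longleftrightarrow> (\<forall>k. 0 \<le> k \<longrightarrow> k \<le> x \<longrightarrow> b k < R)"

lemma enclosed_mono: "enclosed x \<Longrightarrow> x' \<le> x \<Longrightarrow> enclosed x'"
  by (auto simp: enclosed_def)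

lemma psi_nonneg:
  "0 \<le> x \<Longrightarrow> psi x w = - (\<Prod>k\<in>{0..x}. of_real (b k) / (of_real (b k) - w)) / of_real (b x)"
  by (simp add: psi_def primed_prod_def)

lemma psi_neg:
  "x < 0 \<Longrightarrow> psi x w = - (\<Prod>k\<in>{x + 1..-1}. (of_real (b k) - w) / of_real (b k)) / of_real (b x)"
  by (auto simp: psi_def primed_prod_def)

text \<open>The primed product is continued to negative sites so that this recursion passes through
  0, where both sides equal -1.\<close>

lemma psi_step:
  assumes "0 \<le> x \<Longrightarrow> w \<noteq> of_real (b x)"
  shows "(of_real (b x) - w) * psi x w = of_real (b (x - 1)) * psi (x - 1) w"
proof -
  have b: "of_real (b x) \<noteq> (0::complex)" for x using b_pos[of x] by simp
  consider "0 < x" | "x = 0" | "x < 0" by linarith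
  then show ?thesis
  proof cases
    case 1
    then have "{0..x} = insert x {0..x - 1}" by auto
    then show ?thesis using 1 assms b by (simp add: psi_nonneg)
  next
    case 2
    then show ?thesis using assms b[of 0] b[of "-1"] by (simp add: psi_nonneg psi_neg)
  next
    case 3
    then have "{x..-1} = insert x {x + 1..-1}" by auto
    then show ?thesis using 3 b by (simp add: psi_neg)
  qed
qed

lemma bdd_meas_psi:
  assumes x: "enclosed x" and j: "j < n"
  shows "bdd_meas R n (\<lambda>w. psi x (w j))"
proof (cases "0 \<le> x")
  case True
  have frac: "bdd_meas R n (\<lambda>w. of_real (b k) / (of_real (b k) - w j))" if "k \<in> {0..x}" for k
  proof (rule bdd_meas_divide[where d = "R - b k"])
    show "0 < R - b k" using x that by (simp add: enclosed_def)
    show "R - b k \<le> norm (of_real (b k) - w j)" if "w \<in> space (torus R n)" for w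
      using norm_triangle_ineq2[of "w j" "of_real (b k)"] that j b_pos[of k]
      by (simp add: space_torus norm_minus_commute)
  qed (intro bdd_meas_diff bdd_meas_const bdd_meas_coord j)+
  have "bdd_meas R n (\<lambda>w. (- (1 / of_real (b x))) * (\<Prod>k\<in>{0..x}. of_real (b k) / (of_real (b k) - w j)))"
    by (intro bdd_meas_mult bdd_meas_const bdd_meas_prod frac)
  then show ?thesis using True by (simp add: psi_nonneg)
next
  case False
  have "bdd_meas R n (\<lambda>w. (- (1 / of_real (b x))) * (\<Prod>k\<in>{x + 1..-1}. (1 / of_real (b k)) * (of_real (b k) - w j)))"
    by (intro bdd_meas_mult bdd_meas_const bdd_meas_prod bdd_meas_diff bdd_meas_coord j)
  then show ?thesis using False by (simp add: psi_neg)
qed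

section \<open>The many-particle integral and its evolution\<close>

text \<open>The factor \<open>w j\<close> is the density of \<open>dw\<close> with respect to
  \<open>circ R\<close>, up to \<open>2 * pi * \<i>\<close>.\<close>

definition amplitude :: "int list \<Rightarrow> (nat \<Rightarrow> complex) \<Rightarrow> complex" where
  "amplitude X w = bethe q (length X) w * (\<Prod>j<length X. psi (X ! j) (w j) * w j)"

text \<open>\<open>G\<close> is an insertion: 1 gives the integral itself, and \<open>w l\<close>
  the contribution of particle \<open>l\<close> to its time derivative, up to sign. Time is complex,
  so that complex differentiation applies.\<close>

definition wave :: "int list \<Rightarrow> complex \<Rightarrow> ((nat \<Rightarrow> complex) \<Rightarrow> complex) \<Rightarrow> complex" where
  "wave X t G = (\<integral>w. G w * amplitude X w * exp (- t * (\<Sum>j<length X. w j)) \<partial>torus R (length X))"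

lemma bdd_meas_amplitude:
  assumes "\<And>x. x \<in> set X \<Longrightarrow> enclosed x"
  shows "bdd_meas R (length X) (amplitude X)"
  unfolding amplitude_def
  by (intro bdd_meas_mult bdd_meas_bethe bdd_meas_prod bdd_meas_psi bdd_meas_coord) (auto intro: assms)

lemma bdd_meas_sum_coord: "bdd_meas R n (\<lambda>w. \<Sum>j<n. w j)"
  by (intro bdd_meas_sum bdd_meas_coord) simp

lemma bdd_meas_wave:
  assumes "\<And>x. x \<in> set X \<Longrightarrow> enclosed x" "bdd_meas R (length X) G"
  shows "bdd_meas R (length X) (\<lambda>w. G w * amplitude X w * exp (- t * (\<Sum>j<length X. w j)))"
  by (intro bdd_meas_mult assms bdd_meas_amplitude bdd_meas_exp bdd_meas_const bdd_meas_sum_coord)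

lemma integrable_wave:
  assumes "\<And>x. x \<in> set X \<Longrightarrow> enclosed x" "bdd_meas R (length X) G"
  shows "integrable (torus R (length X)) (\<lambda>w. G w * amplitude X w * exp (- t * (\<Sum>j<length X. w j)))"
  by (intro integrable_torus[OF R_pos] bdd_meas_wave assms)

lemma wave_derivative:
  assumes "\<And>x. x \<in> set X \<Longrightarrow> enclosed x"
  shows "((\<lambda>t. wave X t (\<lambda>_. 1)) has_field_derivative - (\<Sum>l<length X. wave X t (\<lambda>w. w l))) (at t)"
proof -
  let ?n = "length X"
  have "(\<integral>w. amplitude X w * (\<Sum>j<?n. w j) * exp (- t * (\<Sum>j<?n. w j)) \<partial>torus R ?n) =
      (\<integral>w. (\<Sum>l<?n. w l * amplitude X w * exp (- t * (\<Sum>j<?n. w j))) \<partial>torus R ?n)"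
    by (intro Bochner_Integration.integral_cong refl) (simp add: sum_distrib_left sum_distrib_right mult_ac)
  also have "\<dots> = (\<Sum>l<?n. wave X t (\<lambda>w. w l))"
    unfolding wave_def
    by (intro Bochner_Integration.integral_sum integrable_wave assms bdd_meas_coord) auto
  finally show ?thesis
    using integral_exp_derivative[OF R_pos bdd_meas_amplitude[OF assms] bdd_meas_sum_coord, of X t]
    by (simp add: wave_def)
qed

text \<open>The boundary condition at a collision. Equal positions make the one-particle factors and
  the exponential symmetric under the exchange, so the sign comes from the Bethe factor
  alone.\<close>

lemma wave_exchange:
  assumes enc: "\<And>x. x \<in> set X \<Longrightarrow> enclosed x" and i: "Suc i < length X" and eq: "X ! i = X ! Suc i"
  shows "wave X t (\<lambda>w. w i) = of_real q * wave X t (\<lambda>w. w (Suc i))"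
proof -
  let ?n = "length X" and ?\<tau> = "Transposition.transpose i (Suc i)"
  let ?F = "\<lambda>w. (w i - of_real q * w (Suc i)) * amplitude X w * exp (- t * (\<Sum>j<?n. w j))"
  have bij: "bij_betw ?\<tau> {..<?n} {..<?n}"
    using i by (intro permutes_imp_bij permutes_swap_id) auto
  have X_\<tau>: "X ! ?\<tau> j = X ! j" for j using eq by (auto simp: Transposition.transpose_def)
  have F: "bdd_meas R ?n ?F"
    using i by (intro bdd_meas_wave enc bdd_meas_diff bdd_meas_mult bdd_meas_const bdd_meas_coord) auto
  have anti: "?F (\<lambda>j\<in>{..<?n}. w (?\<tau> j)) = - ?F w" if w: "w \<in> space (torus R ?n)" for w
  proof -
    define v where "v = (\<lambda>j\<in>{..<?n}. w (?\<tau> j))"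
    have v: "v j = w (?\<tau> j)" if "j < ?n" for j using that by (simp add: v_def)
    have "norm (w i) = R" "norm (w (Suc i)) = R" using w i by (auto simp: space_torus)
    then have "(v i - of_real q * v (Suc i)) * bethe q ?n v = - ((w i - of_real q * w (Suc i)) * bethe q ?n w)"
      using circle_ne[of "w i" "w (Suc i)"] circle_ne[of "w (Suc i)" "w i"]
      by (intro bethe_transpose i v) auto
    moreover have "(\<Prod>j<?n. psi (X ! j) (v j) * v j) = (\<Prod>j<?n. psi (X ! ?\<tau> j) (w (?\<tau> j)) * w (?\<tau> j))"
      by (intro prod.cong) (simp_all add: v X_\<tau>)
    then have "(\<Prod>j<?n. psi (X ! j) (v j) * v j) = (\<Prod>j<?n. psi (X ! j) (w j) * w j)"
      using prod.reindex_bij_betw[OF bij, of "\<lambda>j. psi (X ! j) (w j) * w j"] by simp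
    moreover have "(\<Sum>j<?n. v j) = (\<Sum>j<?n. w (?\<tau> j))" by (intro sum.cong) (simp_all add: v)
    then have "(\<Sum>j<?n. v j) = (\<Sum>j<?n. w j)" using sum.reindex_bij_betw[OF bij, of w] by simp
    ultimately have "?F v = - ?F w"
      by (simp only: amplitude_def mult.assoc[symmetric]) simp
    then show ?thesis by (simp only: v_def)
  qed
  have "(\<integral>w. ?F w \<partial>torus R ?n) = (\<integral>w. ?F (\<lambda>j\<in>{..<?n}. w (?\<tau> j)) \<partial>torus R ?n)"
    by (rule integral_torus_permute[OF R_pos bij F, symmetric])
  also have "\<dots> = (\<integral>w. - ?F w \<partial>torus R ?n)"
    by (intro Bochner_Integration.integral_cong refl anti)
  finally have "(\<integral>w. ?F w \<partial>torus R ?n) = 0" by simp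
  moreover have "(\<integral>w. ?F w \<partial>torus R ?n) = (\<integral>w. w i * amplitude X w * exp (- t * (\<Sum>j<?n. w j)) -
      of_real q * (w (Suc i) * amplitude X w * exp (- t * (\<Sum>j<?n. w j))) \<partial>torus R ?n)"
    by (intro Bochner_Integration.integral_cong refl) (simp add: algebra_simps)
  moreover have "\<dots> = wave X t (\<lambda>w. w i) - of_real q * wave X t (\<lambda>w. w (Suc i))"
  proof -
    have int: "integrable (torus R ?n) (\<lambda>w. w k * amplitude X w * exp (- t * (\<Sum>j<?n. w j)))" if "k < ?n" for k
      by (intro integrable_wave enc bdd_meas_coord that)
    show ?thesis
      using Bochner_Integration.integral_diff[OF int[of i] integrable_mult_right[OF int[of "Suc i"], of "of_real q"]] i
      by (simp only: integral_mult_right_zero wave_def Suc_lessD)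
  qed
  ultimately show ?thesis by simp
qed

text \<open>\<open>psi_step\<close> solved for \<open>w * psi x w\<close>: inserting
  \<open>w l\<close> acts as the free generator of particle \<open>l\<close>, up to sign, with a
  loss at its site and a gain from the site below.\<close>

lemma wave_coord:
  assumes enc: "\<And>x. x \<in> set X \<Longrightarrow> enclosed x" and l: "l < length X"
  shows "wave X t (\<lambda>w. w l) = of_real (b (X ! l)) * wave X t (\<lambda>_. 1)
    - of_real (b (X ! l - 1)) * wave (X[l := X ! l - 1]) t (\<lambda>_. 1)"
proof -
  let ?n = "length X" and ?Y = "X[l := X ! l - 1]"
  have enc_Y: "enclosed x" if "x \<in> set ?Y" for x
    using that enc set_update_subset_insert[of X l] enclosed_mono[OF enc[OF nth_mem[OF l]]] by fastforce
  have key: "w l * amplitude X w = of_real (b (X ! l)) * amplitude X w - of_real (b (X ! l - 1)) * amplitude ?Y w"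
    if w: "w \<in> space (torus R ?n)" for w
  proof -
    have ne: "w l \<noteq> of_real (b (X ! l))" if "0 \<le> X ! l"
    proof
      assume "w l = of_real (b (X ! l))"
      then have "b (X ! l) = R" using w l b_pos[of "X ! l"] by (auto simp: space_torus)
      then show False using enc[OF nth_mem[OF l]] that by (auto simp: enclosed_def)
    qed
    define P where "P = bethe q ?n w * (\<Prod>j\<in>{..<?n} - {l}. psi (X ! j) (w j) * w j)"
    have X: "amplitude X w = P * (psi (X ! l) (w l) * w l)"
      using l by (simp add: amplitude_def P_def prod.remove[of _ l] mult_ac)
    have "(\<Prod>j\<in>{..<?n} - {l}. psi (?Y ! j) (w j) * w j) = (\<Prod>j\<in>{..<?n} - {l}. psi (X ! j) (w j) * w j)"
      by (intro prod.cong) auto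
    then have Y: "amplitude ?Y w = P * (psi (X ! l - 1) (w l) * w l)"
      using l by (simp add: amplitude_def P_def prod.remove[of _ l] mult_ac)
    have "of_real (b (X ! l)) * amplitude X w - w l * amplitude X w =
        P * w l * ((of_real (b (X ! l)) - w l) * psi (X ! l) (w l))"
      by (simp add: X algebra_simps)
    also have "\<dots> = of_real (b (X ! l - 1)) * amplitude ?Y w"
      by (subst psi_step[OF ne]) (simp_all add: Y mult_ac)
    finally show ?thesis by (simp add: algebra_simps)
  qed
  have "wave X t (\<lambda>w. w l) =
      (\<integral>w. of_real (b (X ! l)) * (1 * amplitude X w * exp (- t * (\<Sum>j<?n. w j)))
        - of_real (b (X ! l - 1)) * (1 * amplitude ?Y w * exp (- t * (\<Sum>j<?n. w j))) \<partial>torus R ?n)"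
    unfolding wave_def
    by (intro Bochner_Integration.integral_cong refl) (simp only: key mult_1 left_diff_distrib mult.assoc)
  also have "\<dots> = (\<integral>w. of_real (b (X ! l)) * (1 * amplitude X w * exp (- t * (\<Sum>j<?n. w j))) \<partial>torus R ?n)
      - (\<integral>w. of_real (b (X ! l - 1)) * (1 * amplitude ?Y w * exp (- t * (\<Sum>j<?n. w j))) \<partial>torus R ?n)"
  proof (intro Bochner_Integration.integral_diff integrable_mult_right)
    show "integrable (torus R ?n) (\<lambda>w. 1 * amplitude X w * exp (- t * (\<Sum>j<?n. w j)))"
      by (intro integrable_wave enc bdd_meas_const)
    show "integrable (torus R ?n) (\<lambda>w. 1 * amplitude ?Y w * exp (- t * (\<Sum>j<?n. w j)))"
    proof -
      have "integrable (torus R (length ?Y)) (\<lambda>w. 1 * amplitude ?Y w * exp (- t * (\<Sum>j<length ?Y. w j)))"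
        by (intro integrable_wave enc_Y bdd_meas_const)
      then show ?thesis by (simp only: length_list_update)
    qed
  qed
  finally show ?thesis by (simp only: integral_mult_right_zero wave_def length_list_update)
qed

section \<open>Residue computations for negative sites and for time 0\<close>

lemma psi_neg_holomorphic: "x < 0 \<Longrightarrow> psi x holomorphic_on A"
  using b_pos by (intro holomorphic_cong[THEN iffD2, OF refl psi_neg] holomorphic_intros) (auto simp: less_imp_neq[symmetric])

text \<open>In the last variable nothing is singular inside the disc: \<open>psi\<close> at a
  negative site is a polynomial, and the Bethe denominators stay away from 0. The mean value
  property evaluates the integrand at the centre, where the factor \<open>y\<close> from
  \<open>dw\<close> vanishes.\<close>

lemma wave_negative:
  assumes enc: "\<And>x. x \<in> set X \<Longrightarrow> enclosed x" and X: "X \<noteq> []" "last X < 0"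
  shows "wave X t (\<lambda>_. 1) = 0"
proof -
  obtain m where m: "length X = Suc m" using X(1) by (cases X) auto
  have last: "X ! m < 0" using X m by (simp add: last_conv_nth)
  let ?F = "\<lambda>w. 1 * amplitude X w * exp (- t * (\<Sum>j<Suc m. w j))"
  have F: "bdd_meas R (Suc m) ?F"
    unfolding m[symmetric] by (intro bdd_meas_wave enc bdd_meas_const)
  have "(\<integral>y. ?F (w(m := y)) \<partial>circ R) = 0" if w: "w \<in> space (torus R m)" for w
  proof -
    define C where "C = bethe q m w * (\<Prod>j<m. psi (X ! j) (w j) * w j) * exp (- t * (\<Sum>j<m. w j))"
    define h :: "complex \<Rightarrow> complex" where "h y = C * (\<Prod>i<m. (w i - y) / (w i - of_real q * y)) * psi (X ! m) y * exp (- t * y) * y" for y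
    have "bethe q m (w(m := y)) = bethe q m w" for y by (intro bethe_cong) simp
    moreover have "exp (- (t * (s + y))) = exp (- (t * s)) * exp (- (t * y))" for s y :: complex
      by (simp add: exp_add[symmetric] distrib_left)
    ultimately have "?F (w(m := y)) = h y" for y
      by (simp add: amplitude_def m bethe_Suc h_def C_def mult_ac)
    moreover have "h holomorphic_on cball 0 R"
      unfolding h_def
    proof (intro holomorphic_intros psi_neg_holomorphic last)
      fix y :: complex and i assume "y \<in> cball 0 R" "i \<in> {..<m}"
      then show "w i - of_real q * y \<noteq> 0"
        using w by (intro circle_ne) (auto simp: space_torus)
    qed
    then have "(\<integral>y. h y \<partial>circ R) = h 0" by (rule mean_value_circ[OF R_pos])
    ultimately show ?thesis by (simp add: h_def)
  qed
  then have "(\<integral>w. (\<integral>y. ?F (w(m := y)) \<partial>circ R) \<partial>torus R m) = (\<integral>w. 0 \<partial>torus R m)"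
    by (intro Bochner_Integration.integral_cong refl)
  then show ?thesis
    unfolding wave_def m by (subst integral_torus_Suc[OF R_pos F]) simp
qed

text \<open>Integrating out the last variable replaces the pole \<open>c\<close> of the others by \<open>q c\<close>.\<close>

lemma integral_bethe_poles:
  assumes "norm c < R"
  shows "(\<integral>w. bethe q n w * (\<Prod>j<n. w j / (w j - c)) \<partial>torus R n) = 1"
  using assms
proof (induction n arbitrary: c)
  case 0
  interpret prob_space "torus R 0" by (rule prob_space_torus[OF R_pos])
  show ?case using prob_space by (simp add: bethe_def)
next
  case (Suc m)
  let ?F = "\<lambda>w. bethe q (Suc m) w * (\<Prod>j<Suc m. w j / (w j - c))"
  have gap: "R - norm c \<le> norm (u - c)" if "norm u = R" for u
    using norm_triangle_ineq2[of u c] that by simp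
  have F: "bdd_meas R (Suc m) ?F"
  proof (intro bdd_meas_mult bdd_meas_bethe bdd_meas_prod)
    fix j assume "j \<in> {..<Suc m}"
    then show "bdd_meas R (Suc m) (\<lambda>w. w j / (w j - c))"
      using Suc.prems
      by (intro bdd_meas_divide[where d = "R - norm c"] bdd_meas_diff bdd_meas_coord bdd_meas_const)
        (auto simp: space_torus intro!: gap)
  qed
  have "norm (of_real q * c) < R"
  proof -
    have "q * norm c \<le> 1 * norm c" using q_less by (intro mult_right_mono) auto
    then show ?thesis using Suc.prems q_pos by (simp add: norm_mult)
  qed
  have "(\<integral>y. ?F (w(m := y)) \<partial>circ R) = bethe q m w * (\<Prod>j<m. w j / (w j - of_real q * c))"
    if w: "w \<in> space (torus R m)" for w
  proof -
    define C where "C = bethe q m w * (\<Prod>j<m. w j / (w j - c))"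
    define h where "h y = C * (\<Prod>i<m. (w i - y) / (w i - of_real q * y))" for y
    have w': "norm (w i) = R" if "i < m" for i using w that by (simp add: space_torus)
    have "bethe q m (w(m := y)) = bethe q m w" for y by (intro bethe_cong) simp
    then have "?F (w(m := y)) = h y * y / (y - c)" for y
      by (simp add: bethe_Suc h_def C_def)
    then have "(\<integral>y. ?F (w(m := y)) \<partial>circ R) = (\<integral>y. h y * y / (y - c) \<partial>circ R)"
      by (simp only:)
    moreover have "h holomorphic_on cball 0 R"
      unfolding h_def by (intro holomorphic_intros circle_ne) (auto simp: w')
    then have "(\<integral>y. h y * y / (y - c) \<partial>circ R) = h c" by (rule cauchy_circ[OF R_pos _ Suc.prems])
    \<comment> \<open>The Bethe numerators at \<open>y = c\<close> cancel the old poles, and the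
      denominators supply the new ones.\<close>
    moreover have "h c = bethe q m w * (\<Prod>j<m. w j / (w j - of_real q * c))"
    proof -
      have "w j \<noteq> c" if "j < m" for j using w'[OF that] Suc.prems by auto
      then have "(\<Prod>j<m. w j / (w j - c)) * (\<Prod>j<m. (w j - c) / (w j - of_real q * c)) =
          (\<Prod>j<m. w j / (w j - of_real q * c))"
        unfolding prod.distrib[symmetric] by (intro prod.cong) auto
      then show ?thesis by (simp add: h_def C_def mult.assoc)
    qed
    ultimately show ?thesis by (simp only:)
  qed
  then have "(\<integral>w. ?F w \<partial>torus R (Suc m)) =
      (\<integral>w. bethe q m w * (\<Prod>j<m. w j / (w j - of_real q * c)) \<partial>torus R m)"
    by (subst integral_torus_Suc[OF R_pos F]) (intro Bochner_Integration.integral_cong refl)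
  also have "\<dots> = 1" by (rule Suc.IH) fact
  finally show ?case .
qed

lemma wave_origin:
  assumes "enclosed 0"
  shows "wave (replicate n 0) 0 (\<lambda>_. 1) = 1"
proof -
  have b0: "of_real (b 0) \<noteq> (0::complex)" "norm (of_real (b 0) :: complex) < R"
    using b_pos[of 0] assms by (auto simp: enclosed_def)
  \<comment> \<open>Each variable has a single simple pole, at \<open>b 0\<close>. There both sides
    are 0 by the convention for division by zero.\<close>
  have "psi 0 u * u = u / (u - of_real (b 0))" for u
    using b0 by (cases "u = of_real (b 0)") (auto simp: psi_nonneg divide_simps algebra_simps)
  then have "(\<Prod>j<n. psi (replicate n 0 ! j) (w j) * w j) = (\<Prod>j<n. w j / (w j - of_real (b 0)))" for w
    by (intro prod.cong) auto
  then show ?thesis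
    using integral_bethe_poles[OF b0(2), of n] by (simp add: wave_def amplitude_def)
qed

text \<open>On the circle the conjugate of the integrand in the first variable extends holomorphically
  to the disc, because there the conjugate of \<open>y\<close> is \<open>R\<^sup>2 / y\<close>; this accounts for the decay at infinity.\<close>

lemma wave_initial_zero:
  assumes enc: "\<And>x. x \<in> set X \<Longrightarrow> enclosed x" and X: "X \<noteq> []" "0 < X ! 0"
  shows "wave X 0 (\<lambda>_. 1) = 0"
proof -
  define n where "n = length X"
  define x where "x = X ! 0"
  have n: "0 < n" using X by (simp add: n_def)
  have x: "0 < x" "enclosed x" using X enc by (auto simp: x_def)
  have F: "bdd_meas R n (amplitude X)" unfolding n_def by (intro bdd_meas_amplitude enc)
  have "(\<integral>y. amplitude X (w(0 := y)) \<partial>circ R) = 0"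
    if w: "w \<in> space (\<Pi>\<^sub>M j\<in>{1..<n}. circ R)" for w
  proof -
    define C where "C = (\<Prod>j\<in>{1..<n}. \<Prod>i\<in>{1..<j}. (w i - w j) / (w i - of_real q * w j))
      * (\<Prod>j\<in>{1..<n}. psi (X ! j) (w j) * w j)"
    \<comment> \<open>The conjugate of the integrand with \<open>cnj y\<close> replaced by
      \<open>R\<^sup>2 / y\<close>. The factor \<open>R\<^sup>2 / y\<close> coming from
      \<open>dw\<close> uses up the zero of the fraction at site 0; the fractions at the sites from
      1 to \<open>x\<close> keep theirs, so \<open>h 0 = 0\<close> because \<open>0 < x\<close>. The
      poles, at \<open>R\<^sup>2 / b k\<close> and at modulus \<open>R / q\<close>, lie outside the
      disc.\<close>
    define h where "h y = - cnj C / of_real (b x) *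
      (\<Prod>j\<in>{1..<n}. (of_real (R\<^sup>2) - cnj (w j) * y) / (of_real (R\<^sup>2) - of_real q * (cnj (w j) * y))) *
      (of_real (R\<^sup>2 * b 0) / (of_real (b 0) * y - of_real (R\<^sup>2))) *
      (\<Prod>k\<in>{1..x}. of_real (b k) * y / (of_real (b k) * y - of_real (R\<^sup>2)))" for y
    have w': "norm (w j) = R" if "j \<in> {1..<n}" for j
      using w that by (auto simp: space_PiM PiE_def)
    have lt: "b k * norm y < R\<^sup>2" if "norm y \<le> R" "k \<in> {0..x}" for k y
    proof -
      have "b k * norm y \<le> b k * R" using that b_pos[of k] by (intro mult_left_mono) auto
      also have "\<dots> < R * R" using x(2) that R_pos by (intro mult_strict_right_mono) (auto simp: enclosed_def)
      finally show ?thesis by (simp add: power2_eq_square)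
    qed
    have ne_b: "of_real (b k) * y - of_real (R\<^sup>2) \<noteq> (0::complex)" if "norm y \<le> R" "k \<in> {0..x}" for k y
    proof
      assume "of_real (b k) * y - of_real (R\<^sup>2) = 0"
      then have "of_real (b k) * y = of_real (R\<^sup>2)" by simp
      then have "norm (of_real (b k) * y) = R\<^sup>2" by (simp only: norm_of_real) simp
      then show False using lt[OF that] b_pos[of k] by (simp add: norm_mult)
    qed
    have ne_w: "of_real (R\<^sup>2) - of_real q * (cnj (w j) * y) \<noteq> 0" if "norm y \<le> R" "j \<in> {1..<n}" for j y
    proof
      assume "of_real (R\<^sup>2) - of_real q * (cnj (w j) * y) = 0"
      then have "norm (of_real q * (cnj (w j) * y)) = norm (of_real (R\<^sup>2) :: complex)" by simp
      then have nl: "q * (R * norm y) = R * R" using w'[OF that(2)] q_pos R_pos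
        by (simp add: norm_mult power2_eq_square del: mult_eq_0_iff)
      moreover have "q * (R * norm y) \<le> q * (R * R)"
        using q_pos R_pos that(1) by (intro mult_left_mono) auto
      moreover have "q * (R * R) < 1 * (R * R)"
        using q_less R_pos by (intro mult_strict_right_mono) auto
      ultimately show False using nl by linarith
    qed
    have "amplitude X (w(0 := y)) = cnj (h y)" if y: "norm y = R" for y
    proof -
      have y0: "y \<noteq> 0" using y R_pos by auto
      have cy: "cnj y = of_real (R\<^sup>2) / y"
        using y0 complex_norm_square[of y] y by (simp add: field_simps)
      have "bethe q n (w(0 := y)) = (\<Prod>j\<in>{1..<n}. (y - w j) / (y - of_real q * w j)) *
          (\<Prod>j\<in>{1..<n}. \<Prod>i\<in>{1..<j}. (w i - w j) / (w i - of_real q * w j))"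
        by (simp add: bethe_split_first[OF n])
      moreover have "(\<Prod>j<n. psi (X ! j) ((w(0 := y)) j) * (w(0 := y)) j) =
          psi x y * y * (\<Prod>j\<in>{1..<n}. psi (X ! j) (w j) * w j)"
      proof -
        have "{..<n} = insert 0 {1..<n}" using n by auto
        then show ?thesis by (simp add: x_def)
      qed
      ultimately have "amplitude X (w(0 := y)) = C * (\<Prod>j\<in>{1..<n}. (y - w j) / (y - of_real q * w j)) * (psi x y * y)"
        by (simp add: amplitude_def n_def[symmetric] C_def)
      then have "cnj (amplitude X (w(0 := y))) =
          cnj C * (\<Prod>j\<in>{1..<n}. (cnj y - cnj (w j)) / (cnj y - of_real q * cnj (w j))) * (cnj (psi x y) * cnj y)"
        by simp
      also have "(\<Prod>j\<in>{1..<n}. (cnj y - cnj (w j)) / (cnj y - of_real q * cnj (w j))) =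
          (\<Prod>j\<in>{1..<n}. (of_real (R\<^sup>2) - cnj (w j) * y) / (of_real (R\<^sup>2) - of_real q * (cnj (w j) * y)))"
      proof (intro prod.cong refl)
        fix j
        have "cnj y - cnj (w j) = (of_real (R\<^sup>2) - cnj (w j) * y) / y"
          "cnj y - of_real q * cnj (w j) = (of_real (R\<^sup>2) - of_real q * (cnj (w j) * y)) / y"
          using y0 by (simp_all add: cy field_simps)
        then show "(cnj y - cnj (w j)) / (cnj y - of_real q * cnj (w j)) =
            (of_real (R\<^sup>2) - cnj (w j) * y) / (of_real (R\<^sup>2) - of_real q * (cnj (w j) * y))"
          using y0 by simp
      qed
      also have "cnj (psi x y) * cnj y = - 1 / of_real (b x) *
          (of_real (R\<^sup>2 * b 0) / (of_real (b 0) * y - of_real (R\<^sup>2))) *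
          (\<Prod>k\<in>{1..x}. of_real (b k) * y / (of_real (b k) * y - of_real (R\<^sup>2)))"
      proof -
        have frac: "of_real (b k) / (of_real (b k) - cnj y) = of_real (b k) * y / (of_real (b k) * y - of_real (R\<^sup>2))" for k
        proof -
          have "of_real (b k) - cnj y = (of_real (b k) * y - of_real (R\<^sup>2)) / y"
            using y0 by (simp add: cy field_simps)
          then show ?thesis by simp
        qed
        have "{0..x} = insert 0 {1..x}" using x by auto
        then have "cnj (psi x y) = - (of_real (b 0) / (of_real (b 0) - cnj y) *
            (\<Prod>k\<in>{1..x}. of_real (b k) / (of_real (b k) - cnj y))) / of_real (b x)"
          using x by (simp add: psi_nonneg)
        also have "\<dots> = - 1 / of_real (b x) * (of_real (b 0) * y / (of_real (b 0) * y - of_real (R\<^sup>2))) *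
            (\<Prod>k\<in>{1..x}. of_real (b k) * y / (of_real (b k) * y - of_real (R\<^sup>2)))"
          unfolding frac by simp
        finally show ?thesis using y0 by (simp add: cy mult_ac)
      qed
      also have "cnj C *
          (\<Prod>j\<in>{1..<n}. (of_real (R\<^sup>2) - cnj (w j) * y) / (of_real (R\<^sup>2) - of_real q * (cnj (w j) * y))) *
          (- 1 / of_real (b x) * (of_real (R\<^sup>2 * b 0) / (of_real (b 0) * y - of_real (R\<^sup>2))) *
          (\<Prod>k\<in>{1..x}. of_real (b k) * y / (of_real (b k) * y - of_real (R\<^sup>2)))) = h y"
        by (simp add: h_def mult_ac)
      finally have "cnj (amplitude X (w(0 := y))) = h y" .
      then show ?thesis by (metis complex_cnj_cnj)
    qed
    then have "(\<integral>y. amplitude X (w(0 := y)) \<partial>circ R) = (\<integral>y. cnj (h y) \<partial>circ R)"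
      by (intro Bochner_Integration.integral_cong refl) simp
    also have "\<dots> = cnj (h 0)"
    proof -
      have "h holomorphic_on cball 0 R"
        unfolding h_def using x by (intro holomorphic_intros ne_b ne_w) auto
      then show ?thesis by (simp add: mean_value_circ[OF R_pos])
    qed
    also have "cnj (h 0) = 0" using x by (auto simp: h_def)
    finally show ?thesis .
  qed
  then have "(\<integral>w. (\<integral>y. amplitude X (w(0 := y)) \<partial>circ R) \<partial>(\<Pi>\<^sub>M j\<in>{1..<n}. circ R)) =
      (\<integral>w. 0 \<partial>(\<Pi>\<^sub>M j\<in>{1..<n}. circ R))"
    by (intro Bochner_Integration.integral_cong refl)
  then show ?thesis
    using integral_torus_first[OF R_pos n F] by (simp add: wave_def n_def)
qed

end


section \<open>Stacks and levels of the $q$-TAZRP\<close>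

text \<open>A particle that jumps onto an occupied site gets the largest index there. Undoing the
  jump that led to a state therefore lowers the bottom of a stack, although jumps start at
  tops.\<close>

definition bottom_of_stack :: "int list \<Rightarrow> nat \<Rightarrow> bool" where
  "bottom_of_stack x k \<longleftrightarrow> k < length x \<and> (Suc k = length x \<or> x ! k > x ! Suc k)"

definition q_int :: "real \<Rightarrow> nat \<Rightarrow> real" where
  "q_int q k = (1 - q ^ k) / (1 - q)"

lemma q_fact_Suc: "q_fact q (Suc k) = q_fact q k * q_int q (Suc k)"
  by (simp add: q_fact_def q_int_def)

lemma q_int_Suc: "q \<noteq> 1 \<Longrightarrow> q_int q (Suc k) = 1 + q * q_int q k"
  by (simp add: q_int_def divide_simps) (simp add: algebra_simps)

lemma q_int_pos: "0 < q \<Longrightarrow> q < 1 \<Longrightarrow> 0 < k \<Longrightarrow> 0 < q_int q k"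
  by (simp add: q_int_def power_less_one_iff)

lemma q_fact_pos: "0 < q \<Longrightarrow> q < 1 \<Longrightarrow> 0 < q_fact q k"
  by (induction k) (simp_all add: q_fact_Suc q_int_pos, simp add: q_fact_def)

lemma stack_weight_pos: "0 < q \<Longrightarrow> q < 1 \<Longrightarrow> 0 < stack_weight q x"
  by (simp add: stack_weight_def prod_pos q_fact_pos)

lemma finite_stack_ends [simp]: "finite {k. top_of_stack x k}" "finite {k. bottom_of_stack x k}"
  by (auto simp: top_of_stack_def bottom_of_stack_def)

section \<open>Sums over the tops and bottoms of stacks\<close>

lemma bottom_of_stack_snoc:
  assumes "sorted_wrt (\<ge>) (xs @ [y, x])"
  shows "{k. bottom_of_stack (xs @ [y, x]) k} = insert (Suc (length xs))
    (if y = x then {k. bottom_of_stack (xs @ [y]) k} - {length xs} else {k. bottom_of_stack (xs @ [y]) k})"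
    (is "?L = ?R")
proof (rule set_eqI)
  fix k
  have "x \<le> y" using assms by (simp add: sorted_wrt_append)
  consider "Suc k < length xs" | "Suc k = length xs" | "k = length xs" | "k = Suc (length xs)" | "k > Suc (length xs)"
    by linarith
  then show "k \<in> ?L \<longleftrightarrow> k \<in> ?R"
    using \<open>x \<le> y\<close> by cases (auto simp: bottom_of_stack_def nth_append)
qed

lemma top_of_stack_snoc:
  assumes "sorted_wrt (\<ge>) (xs @ [y, x])"
  shows "{k. top_of_stack (xs @ [y, x]) k} =
    (if y = x then {k. top_of_stack (xs @ [y]) k} else insert (Suc (length xs)) {k. top_of_stack (xs @ [y]) k})"
    (is "?L = ?R")
proof (rule set_eqI)
  fix k
  have "x \<le> y" using assms by (simp add: sorted_wrt_append)
  consider "k < length xs" | "k = length xs" | "k = Suc (length xs)" | "k > Suc (length xs)"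
    by linarith
  then show "k \<in> ?L \<longleftrightarrow> k \<in> ?R"
    using \<open>x \<le> y\<close> by cases (auto simp: top_of_stack_def nth_append)
qed

lemma bottom_of_stack_last: "bottom_of_stack (xs @ [x]) (length xs)"
  by (simp add: bottom_of_stack_def)

text \<open>Induction by appending one particle: it either enlarges the last stack or opens a new
  one, so comparing the last two entries decides.\<close>

lemma sorted_snoc_cases [consumes 1, case_names Nil Single Snoc]:
  assumes "sorted_wrt (\<ge>) (X :: int list)"
    and "P []" "\<And>x. P [x]"
    and "\<And>xs y x. sorted_wrt (\<ge>) (xs @ [y, x]) \<Longrightarrow> P (xs @ [y]) \<Longrightarrow> P (xs @ [y, x])"
  shows "P X"
  using assms(1)
proof (induction X rule: rev_induct)
  case (snoc x X)
  show ?case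
  proof (cases X rule: rev_cases)
    case (snoc xs y)
    then have "sorted_wrt (\<ge>) (xs @ [y, x])" "P (xs @ [y])"
      using snoc.prems snoc.IH by (simp_all add: sorted_wrt_append)
    then show ?thesis using assms(4) snoc by simp
  qed (use assms(3) in simp)
qed (use assms(2) in simp)

text \<open>Every occupied site has exactly one top. As it also has exactly one bottom, the set of
  sites mediates between sums over tops and sums over bottoms.\<close>

lemma sum_top_of_stack:
  fixes h :: "int \<Rightarrow> real"
  assumes "sorted_wrt (\<ge>) X"
  shows "(\<Sum>k | top_of_stack X k. h (X ! k)) = (\<Sum>s\<in>set X. h s)"
  using assms
proof (induction rule: sorted_snoc_cases)
  case (Single x)
  have "{k. top_of_stack [x] k} = {0}" by (auto simp: top_of_stack_def)
  then show ?case by simp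
next
  case (Snoc xs y x)
  have same: "(\<Sum>k | top_of_stack (xs @ [y]) k. h ((xs @ [y, x]) ! k)) = (\<Sum>k | top_of_stack (xs @ [y]) k. h ((xs @ [y]) ! k))"
    by (intro sum.cong) (auto simp: top_of_stack_def nth_append less_Suc_eq)
  have new: "Suc (length xs) \<notin> {k. top_of_stack (xs @ [y]) k}" by (simp add: top_of_stack_def)
  have nth: "(xs @ [y, x]) ! Suc (length xs) = x" by (simp add: nth_append)
  show ?case
  proof (cases "y = x")
    case True
    then have "set (xs @ [y, x]) = set (xs @ [y])" by auto
    moreover have "{k. top_of_stack (xs @ [y, x]) k} = {k. top_of_stack (xs @ [y]) k}"
      using top_of_stack_snoc[OF Snoc(1)] True by simp
    ultimately show ?thesis using Snoc(2) same by (simp only:)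
  next
    case False
    then have "x \<notin> set (xs @ [y])" using Snoc(1) by (auto simp: sorted_wrt_append)
    then have set: "sum h (insert x (set (xs @ [y]))) = h x + sum h (set (xs @ [y]))"
      by (intro sum.insert) simp_all
    have "set (xs @ [y, x]) = insert x (set (xs @ [y]))" by auto
    moreover have "{k. top_of_stack (xs @ [y, x]) k} = insert (Suc (length xs)) {k. top_of_stack (xs @ [y]) k}"
      using top_of_stack_snoc[OF Snoc(1)] False by simp
    moreover have "(\<Sum>k\<in>insert (Suc (length xs)) {k. top_of_stack (xs @ [y]) k}. h ((xs @ [y, x]) ! k)) =
        h ((xs @ [y, x]) ! Suc (length xs)) + (\<Sum>k\<in>{k. top_of_stack (xs @ [y]) k}. h ((xs @ [y, x]) ! k))"
      by (rule sum.insert) (use new in simp_all)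
    ultimately show ?thesis
      using Snoc(2) set same nth by (simp only:)
  qed
qed (simp add: top_of_stack_def)

lemma sum_bottom_of_stack:
  fixes h :: "int \<Rightarrow> real"
  assumes "sorted_wrt (\<ge>) X"
  shows "(\<Sum>k | bottom_of_stack X k. h (X ! k)) = (\<Sum>s\<in>set X. h s)"
  using assms
proof (induction rule: sorted_snoc_cases)
  case (Single x)
  have "{k. bottom_of_stack [x] k} = {0}" by (auto simp: bottom_of_stack_def)
  then show ?case by simp
next
  case (Snoc xs y x)
  let ?B = "{k. bottom_of_stack (xs @ [y]) k}"
  have same: "(\<Sum>k\<in>A. h ((xs @ [y, x]) ! k)) = (\<Sum>k\<in>A. h ((xs @ [y]) ! k))" if "A \<subseteq> ?B" for A
    using that by (intro sum.cong) (auto simp: bottom_of_stack_def nth_append less_Suc_eq subset_iff)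
  have new: "Suc (length xs) \<notin> ?B" by (simp add: bottom_of_stack_def)
  have nth: "(xs @ [y, x]) ! Suc (length xs) = x" by (simp add: nth_append)
  show ?case
  proof (cases "y = x")
    case True
    have "(\<Sum>k\<in>?B. h ((xs @ [y]) ! k)) = h y + (\<Sum>k\<in>?B - {length xs}. h ((xs @ [y]) ! k))"
      using bottom_of_stack_last[of xs y] by (subst sum.remove[of _ "length xs"]) auto
    moreover have "set (xs @ [y, x]) = set (xs @ [y])" using True by auto
    moreover have "(\<Sum>k | bottom_of_stack (xs @ [y, x]) k. h ((xs @ [y, x]) ! k)) =
        h x + (\<Sum>k\<in>?B - {length xs}. h ((xs @ [y]) ! k))"
    proof -
      have "{k. bottom_of_stack (xs @ [y, x]) k} = insert (Suc (length xs)) (?B - {length xs})"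
        using bottom_of_stack_snoc[OF Snoc(1)] True by simp
      then show ?thesis using new nth same[of "?B - {length xs}"] by simp
    qed
    ultimately show ?thesis using True Snoc(2) by simp
  next
    case False
    then have "x \<notin> set (xs @ [y])" using Snoc(1) by (auto simp: sorted_wrt_append)
    then have set: "sum h (insert x (set (xs @ [y]))) = h x + sum h (set (xs @ [y]))"
      by (intro sum.insert) simp_all
    have "set (xs @ [y, x]) = insert x (set (xs @ [y]))" by auto
    moreover have "{k. bottom_of_stack (xs @ [y, x]) k} = insert (Suc (length xs)) ?B"
      using bottom_of_stack_snoc[OF Snoc(1)] False by simp
    moreover have "(\<Sum>k\<in>insert (Suc (length xs)) ?B. h ((xs @ [y, x]) ! k)) =
        h ((xs @ [y, x]) ! Suc (length xs)) + (\<Sum>k\<in>?B. h ((xs @ [y, x]) ! k))"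
      by (rule sum.insert) (use new in simp_all)
    ultimately show ?thesis
      using Snoc(2) set same[OF order_refl] nth by (simp only:)
  qed
qed (simp add: bottom_of_stack_def)

text \<open>Inside a stack the terms form a geometric sequence, so its sum is a \<open>q\<close>-integer times
  the term of the bottom particle.\<close>

lemma sum_over_stacks:
  fixes c :: "nat \<Rightarrow> complex"
  assumes "sorted_wrt (\<ge>) X" and q: "q \<noteq> 1"
    and "\<And>i. Suc i < length X \<Longrightarrow> X ! i = X ! Suc i \<Longrightarrow> c i = of_real q * c (Suc i)"
  shows "(\<Sum>l<length X. c l) = (\<Sum>k | bottom_of_stack X k. of_real (q_int q (count_list X (X ! k))) * c k)"
  using assms(1,3)
proof (induction rule: sorted_snoc_cases)
  case (Single x)
  have "{k. bottom_of_stack [x] k} = {0}" by (auto simp: bottom_of_stack_def)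
  then show ?case using q by (simp add: q_int_def)
next
  case (Snoc xs y x)
  let ?B = "{k. bottom_of_stack (xs @ [y]) k}" and ?m = "length xs"
  let ?f = "\<lambda>k. of_real (q_int q (count_list (xs @ [y]) ((xs @ [y]) ! k))) * c k"
  let ?g = "\<lambda>k. of_real (q_int q (count_list (xs @ [y, x]) ((xs @ [y, x]) ! k))) * c k"
  have yx: "x \<le> y" "\<And>z. z \<in> set xs \<Longrightarrow> y \<le> z" using Snoc(1) by (auto simp: sorted_wrt_append)
  have IH: "(\<Sum>l<Suc ?m. c l) = (\<Sum>k\<in>?B. ?f k)"
  proof -
    have "(\<Sum>l<length (xs @ [y]). c l) = (\<Sum>k\<in>?B. ?f k)"
    proof (rule Snoc.IH)
      fix i assume i: "Suc i < length (xs @ [y])" "(xs @ [y]) ! i = (xs @ [y]) ! Suc i"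
      show "c i = of_real q * c (Suc i)"
        by (rule Snoc.prems) (use i in \<open>auto simp: nth_append less_Suc_eq split: if_splits\<close>)
    qed
    then show ?thesis by simp
  qed
  have above: "?g k = ?f k" if k: "k \<in> ?B" "k \<noteq> ?m \<or> y \<noteq> x" for k
  proof -
    have "k < Suc ?m" using k by (simp add: bottom_of_stack_def)
    then have nth: "(xs @ [y, x]) ! k = (xs @ [y]) ! k" by (auto simp: nth_append less_Suc_eq)
    \<comment> \<open>A bottom other than the last one sits strictly above \<open>y\<close>, hence
      above \<open>x\<close>, so appending \<open>x\<close> does not change the height of its
      stack.\<close>
    have "(xs @ [y]) ! k \<noteq> x"
    proof (cases "k = ?m")
      case False
      then have "(xs @ [y]) ! k > (xs @ [y]) ! Suc k" and "Suc k < length (xs @ [y])"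
        using k(1) by (auto simp: bottom_of_stack_def)
      moreover have "(xs @ [y]) ! Suc k \<in> set (xs @ [y])" using \<open>Suc k < length (xs @ [y])\<close> by (rule nth_mem)
      ultimately show ?thesis using yx by fastforce
    qed (use k in \<open>simp add: nth_append\<close>)
    then show ?thesis by (simp add: nth)
  qed
  have new: "Suc ?m \<notin> ?B" by (simp add: bottom_of_stack_def)
  have nth: "(xs @ [y, x]) ! Suc ?m = x" by (simp add: nth_append)
  have step: "(\<Sum>l<length (xs @ [y, x]). c l) = (\<Sum>k\<in>?B. ?f k) + c (Suc ?m)"
    using IH by simp
  show ?case
  proof (cases "y = x")
    case True
    \<comment> \<open>The old bottom hands its role over to the appended particle. Its term is
      \<open>q\<close> times the new one, and \<open>q_int_Suc\<close> absorbs this factor into the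
      new height.\<close>
    have c: "c ?m = of_real q * c (Suc ?m)"
      by (rule Snoc.prems) (simp_all add: nth_append True)
    have "(\<Sum>k\<in>?B. ?f k) = ?f ?m + (\<Sum>k\<in>?B - {?m}. ?f k)"
      using bottom_of_stack_last[of xs y] by (intro sum.remove) auto
    moreover have "(\<Sum>k | bottom_of_stack (xs @ [y, x]) k. ?g k) = ?g (Suc ?m) + (\<Sum>k\<in>?B - {?m}. ?g k)"
    proof -
      have "{k. bottom_of_stack (xs @ [y, x]) k} = insert (Suc ?m) (?B - {?m})"
        using bottom_of_stack_snoc[OF Snoc(1)] True by simp
      then show ?thesis by (simp only:) (rule sum.insert, use new in simp_all)
    qed
    moreover have "(\<Sum>k\<in>?B - {?m}. ?g k) = (\<Sum>k\<in>?B - {?m}. ?f k)"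
      by (intro sum.cong refl above) auto
    moreover have "?g (Suc ?m) = ?f ?m + c (Suc ?m)"
    proof -
      have "count_list (xs @ [y, x]) x = Suc (count_list (xs @ [y]) y)" using True by simp
      then show ?thesis
        unfolding nth using q by (simp add: q_int_Suc nth_append c algebra_simps del: count_list_append)
    qed
    ultimately show ?thesis unfolding step by simp
  next
    case False
    then have "x \<notin> set (xs @ [y])" using yx by fastforce
    then have "count_list (xs @ [y, x]) x = 1" by simp
    then have "?g (Suc ?m) = c (Suc ?m)" unfolding nth using q by (simp add: q_int_def)
    moreover have "(\<Sum>k | bottom_of_stack (xs @ [y, x]) k. ?g k) = ?g (Suc ?m) + (\<Sum>k\<in>?B. ?g k)"
    proof -
      have "{k. bottom_of_stack (xs @ [y, x]) k} = insert (Suc ?m) ?B"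
        using bottom_of_stack_snoc[OF Snoc(1)] False by simp
      then show ?thesis by (simp only:) (rule sum.insert, use new in simp_all)
    qed
    moreover have "(\<Sum>k\<in>?B. ?g k) = (\<Sum>k\<in>?B. ?f k)"
      using False by (intro sum.cong refl above) auto
    ultimately show ?thesis unfolding step by simp
  qed
next
  case Nil
  have "{k. bottom_of_stack [] k} = {}" by (simp add: bottom_of_stack_def)
  then show ?case by simp
qed

section \<open>Stack weights under a move\<close>

text \<open>An equation between sums avoids truncated subtraction and covers the case of equal old
  and new entries.\<close>

lemma count_list_update:
  "i < length xs \<Longrightarrow>
    count_list (xs[i := y]) s + (if xs ! i = s then 1 else 0) = count_list xs s + (if y = s then 1 else 0)"
  using count_mset_gt_0[OF nth_mem, of i xs] by (auto simp: count_mset[symmetric] mset_update)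

lemma sum_list_int_update: "i < length xs \<Longrightarrow> sum_list (xs[i := y]) = sum_list xs - xs ! i + (y :: int)"
  by (induction xs arbitrary: i) (auto split: nat.splits simp: less_Suc_eq_0_disj)

text \<open>Empty sites contribute \<open>q_fact q 0 = 1\<close>, so two configurations can be
  compared over a common set of sites.\<close>

lemma stack_weight_superset:
  assumes "finite A" "set x \<subseteq> A"
  shows "stack_weight q x = (\<Prod>s\<in>A. q_fact q (count_list x s))"
  unfolding stack_weight_def using assms
  by (intro prod.mono_neutral_left) (auto simp: q_fact_def)

text \<open>The purpose of the weight: the collapsed free jumps carry the height of the stack at the
  site of arrival, whereas the true rate depends on the height of the stack that the particle left.
  Dividing by the weight exchanges one height for the other.\<close>

lemma stack_weight_move:
  assumes j: "j < length X"
  shows "stack_weight q (X[j := X ! j - 1]) * q_int q (count_list X (X ! j)) =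
    stack_weight q X * q_int q (Suc (count_list X (X ! j - 1)))"
proof -
  define m where "m = X ! j"
  define A where "A = set X - {m, m - 1}"
  let ?Y = "X[j := m - 1]"
  have fin: "finite A" and A: "m \<notin> A" "m - 1 \<notin> A" by (auto simp: A_def)
  have m: "m \<in> set X" using j by (simp add: m_def)
  have W: "stack_weight q x = q_fact q (count_list x m) * (q_fact q (count_list x (m - 1)) *
      (\<Prod>s\<in>A. q_fact q (count_list x s)))" if "set x \<subseteq> insert m (insert (m - 1) A)" for x
    using stack_weight_superset[OF _ that] fin A by simp
  have "set ?Y \<subseteq> insert m (insert (m - 1) A)" "set X \<subseteq> insert m (insert (m - 1) A)"
    using set_update_subset_insert[of X j "m - 1"] unfolding A_def by blast+
  note W = this[THEN W]
  have count: "count_list ?Y s + (if m = s then 1 else 0) = count_list X s + (if m - 1 = s then 1 else 0)" for s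
    using count_list_update[OF j, of "m - 1" s] by (simp add: m_def)
  have "count_list X m \<noteq> 0" using m by (simp add: count_list_0_iff)
  then obtain h where h: "count_list X m = Suc h" by (cases "count_list X m") auto
  then have "count_list ?Y m = h" using count[of m] by simp
  moreover have "count_list ?Y (m - 1) = Suc (count_list X (m - 1))" using count[of "m - 1"] by simp
  moreover have "(\<Prod>s\<in>A. q_fact q (count_list ?Y s)) = (\<Prod>s\<in>A. q_fact q (count_list X s))"
  proof (intro prod.cong refl)
    fix s assume "s \<in> A"
    then have "m \<noteq> s" "m - 1 \<noteq> s" using A by auto
    then show "q_fact q (count_list ?Y s) = q_fact q (count_list X s)" using count[of s] by simp
  qed
  ultimately show ?thesis
    unfolding m_def[symmetric] W by (simp add: h q_fact_Suc)
qed

section \<open>Configurations, rates and levels\<close>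

lemma configs_nth_mono: "x \<in> configs n \<Longrightarrow> i \<le> j \<Longrightarrow> j < n \<Longrightarrow> x ! j \<le> x ! i"
  by (cases "i = j") (auto simp: configs_def sorted_wrt_iff_nth_less)

lemma configs_step_up:
  assumes x: "x \<in> configs n" and k: "top_of_stack x k"
  shows "x[k := x ! k + 1] \<in> configs n"
proof -
  have len: "length x = n" using x by (simp add: configs_def)
  have "x[k := x ! k + 1] ! j \<le> x[k := x ! k + 1] ! i" if ij: "i < j" "j < n" for i j
  proof (cases "j = k")
    case True
    then have "x ! (k - 1) > x ! k" using k ij by (auto simp: top_of_stack_def)
    moreover have "x ! (k - 1) \<le> x ! i" using ij True by (intro configs_nth_mono[OF x]) auto
    ultimately show ?thesis using ij True len by simp
  next
    case False
    have "x ! j \<le> x ! i" using ij by (intro configs_nth_mono[OF x]) auto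
    then show ?thesis using False ij len by (cases "i = k") auto
  qed
  then show ?thesis using len by (simp add: configs_def sorted_wrt_iff_nth_less)
qed

lemma configs_step_down:
  assumes x: "x \<in> configs n" and k: "bottom_of_stack x k"
  shows "x[k := x ! k - 1] \<in> configs n" and "top_of_stack (x[k := x ! k - 1]) k"
proof -
  have len: "length x = n" using x by (simp add: configs_def)
  have kn: "k < n" using k len by (simp add: bottom_of_stack_def)
  have "x[k := x ! k - 1] ! j \<le> x[k := x ! k - 1] ! i" if ij: "i < j" "j < n" for i j
  proof (cases "i = k")
    case True
    then have "x ! k > x ! Suc k" using k ij len by (auto simp: bottom_of_stack_def)
    moreover have "x ! j \<le> x ! Suc k" using ij True by (intro configs_nth_mono[OF x]) auto
    ultimately show ?thesis using ij True len by simp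
  next
    case False
    have "x ! j \<le> x ! i" using ij by (intro configs_nth_mono[OF x]) auto
    then show ?thesis using False ij len by (cases "j = k") auto
  qed
  then show "x[k := x ! k - 1] \<in> configs n" using len by (simp add: configs_def sorted_wrt_iff_nth_less)
  show "top_of_stack (x[k := x ! k - 1]) k"
    using configs_nth_mono[OF x, of "k - 1" k] kn len by (cases "k = 0") (auto simp: top_of_stack_def)
qed

lemma list_update_add_inject:
  fixes x :: "int list"
  assumes "x[j := x ! j + d] = x[k := x ! k + d]" "j < length x" "k < length x" "d \<noteq> 0"
  shows "j = k"
proof (rule ccontr)
  assume "j \<noteq> k"
  moreover have "x[j := x ! j + d] ! k = x[k := x ! k + d] ! k" by (simp only: assms(1))
  ultimately show False using assms(2-4) by simp
qed

lemma tazrp_rate_step: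
  assumes "top_of_stack x k"
  shows "tazrp_rate q a x (x[k := x ! k + 1]) = a (x ! k) * (1 - q ^ count_list x (x ! k))"
proof -
  have k: "k < length x" using assms by (simp add: top_of_stack_def)
  have "tazrp_rate q a x (x[k := x ! k + 1]) =
      (\<Sum>j<length x. if j = k then a (x ! k) * (1 - q ^ count_list x (x ! k)) else 0)"
    unfolding tazrp_rate_def using assms k by (intro sum.cong refl) (auto dest: list_update_add_inject)
  then show ?thesis using k by simp
qed

lemma tazrp_rate_nonzero:
  assumes "tazrp_rate q a x x' \<noteq> 0"
  obtains k where "top_of_stack x k" "x' = x[k := x ! k + 1]"
proof (rule ccontr)
  assume "\<not> thesis"
  then have "\<not> (top_of_stack x k \<and> x' = x[k := x ! k + 1])" for k using that by blast
  then have "tazrp_rate q a x x' = 0" unfolding tazrp_rate_def by (intro sum.neutral) auto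
  then show False using assms by simp
qed

lemma tazrp_rate_nonneg:
  assumes "0 < q" "q < 1" "\<And>i. 0 < a i"
  shows "0 \<le> tazrp_rate q a x x'"
  unfolding tazrp_rate_def using assms
  by (intro sum_nonneg) (auto intro!: mult_nonneg_nonneg less_imp_le[OF assms(3)] simp: power_le_one)

text \<open>The sum counts the jumps made from the origin; nonnegativity makes the set
  finite.\<close>

definition level :: "nat \<Rightarrow> nat \<Rightarrow> int list set" where
  "level n k = {x \<in> configs n. (\<forall>s\<in>set x. 0 \<le> s) \<and> sum_list x = int k}"

lemma nonneg_le_sum_list: "x \<in> set xs \<Longrightarrow> \<forall>s\<in>set xs. 0 \<le> s \<Longrightarrow> x \<le> sum_list (xs :: int list)"
  using sum_list_nonneg by (induction xs) fastforce+

lemma finite_level: "finite (level n k)"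
proof (rule finite_subset)
  show "level n k \<subseteq> {xs. set xs \<subseteq> {0..int k} \<and> length xs = n}"
    using nonneg_le_sum_list by (fastforce simp: level_def configs_def)
  show "finite {xs. set xs \<subseteq> {0..int k} \<and> length xs = n}" by (rule finite_lists_length_eq) simp
qed

lemma level_0: "level n 0 = {replicate n 0}"
proof -
  have "x = replicate n 0" if x: "x \<in> level n 0" for x
  proof (rule replicate_eqI)
    show "length x = n" using x by (simp add: level_def configs_def)
    show "s = 0" if "s \<in> set x" for s
      using x that nonneg_le_sum_list[OF that] by (force simp: level_def)
  qed
  moreover have "replicate n 0 \<in> level n 0"
    by (auto simp: level_def configs_def sorted_wrt_iff_nth_less sum_list_replicate)
  ultimately show ?thesis by blast
qed

lemma level_step_up:
  assumes x: "x \<in> level n k" and j: "top_of_stack x j"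
  shows "x[j := x ! j + 1] \<in> level n (Suc k)"
proof -
  have len: "j < length x" using j by (simp add: top_of_stack_def)
  then have "0 \<le> x ! j" using x by (simp add: level_def)
  then have "\<forall>s\<in>set (x[j := x ! j + 1]). 0 \<le> s"
    using x set_update_subset_insert[of x j] by (fastforce simp: level_def)
  then show ?thesis
    using configs_step_up[OF _ j] x len by (simp add: level_def sum_list_int_update)
qed

lemma sum_tazrp_rate_level:
  assumes x: "x \<in> level n k"
  shows "(\<Sum>x'\<in>level n (Suc k). tazrp_rate q a x x') =
    (\<Sum>j | top_of_stack x j. a (x ! j) * (1 - q ^ count_list x (x ! j)))"
proof -
  have "(\<Sum>x'\<in>level n (Suc k). tazrp_rate q a x x') = (\<Sum>x'\<in>(\<lambda>j. x[j := x ! j + 1]) ` {j. top_of_stack x j}. tazrp_rate q a x x')"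
    using level_step_up[OF x] finite_level
    by (intro sum.mono_neutral_right) (auto elim: tazrp_rate_nonzero)
  also have "\<dots> = (\<Sum>j | top_of_stack x j. tazrp_rate q a x (x[j := x ! j + 1]))"
    by (subst sum.reindex) (auto intro!: inj_onI dest: list_update_add_inject simp: top_of_stack_def)
  also have "\<dots> = (\<Sum>j | top_of_stack x j. a (x ! j) * (1 - q ^ count_list x (x ! j)))"
    by (intro sum.cong) (auto simp: tazrp_rate_step)
  finally show ?thesis .
qed

lemma total_rate_level:
  assumes x: "x \<in> level n k"
  shows "total_rate (tazrp_rate q a) x = (\<Sum>x'\<in>level n (Suc k). tazrp_rate q a x x')"
proof -
  have "total_rate (tazrp_rate q a) x = infsum (tazrp_rate q a x) (level n (Suc k))"
    unfolding total_rate_def using level_step_up[OF x]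
    by (intro infsum_cong_neutral) (auto elim: tazrp_rate_nonzero)
  then show ?thesis by (simp add: finite_level)
qed

text \<open>The dynamics gives a sum over tops, but the Bethe side produces sums over
  bottoms.\<close>

lemma total_rate_bottom:
  assumes x: "x \<in> level n k" and q: "q \<noteq> 1"
  shows "total_rate (tazrp_rate q a) x =
    (\<Sum>j | bottom_of_stack x j. a (x ! j) * (1 - q) * q_int q (count_list x (x ! j)))"
proof -
  have sorted: "sorted_wrt (\<ge>) x" using x by (simp add: level_def configs_def)
  let ?h = "\<lambda>s. a s * (1 - q ^ count_list x s)"
  have "total_rate (tazrp_rate q a) x = (\<Sum>j | top_of_stack x j. ?h (x ! j))"
    by (simp add: total_rate_level[OF x] sum_tazrp_rate_level[OF x])
  also have "\<dots> = (\<Sum>j | bottom_of_stack x j. ?h (x ! j))"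
    using sum_top_of_stack[OF sorted, of ?h] sum_bottom_of_stack[OF sorted, of ?h] by simp
  finally show ?thesis using q by (simp add: q_int_def)
qed

lemma total_rate_level_pos:
  assumes x: "x \<in> level n k" and n: "1 \<le> n" and q: "0 < q" "q < 1" and a: "\<And>i. 0 < a i"
  shows "0 < total_rate (tazrp_rate q a) x"
  unfolding total_rate_level[OF x] sum_tazrp_rate_level[OF x]
proof (rule sum_pos)
  have len: "length x = n" using x by (simp add: level_def configs_def)
  have "top_of_stack x 0" using len n by (simp add: top_of_stack_def)
  then show "{j. top_of_stack x j} \<noteq> {}" by blast
  fix j assume "j \<in> {j. top_of_stack x j}"
  then have "x ! j \<in> set x" by (simp add: top_of_stack_def)
  then have "0 < count_list x (x ! j)" by (simp add: count_list_0_iff neq0_conv[symmetric] del: neq0_conv)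
  then show "0 < a (x ! j) * (1 - q ^ count_list x (x ! j))"
    using q a by (simp add: power_less_one_iff)
qed simp

text \<open>A bottom particle at site 0 yields a term on the right without a state on the left; the
  vanishing of \<open>f\<close> off the level takes care of it. The \<open>Suc\<close> counts the
  jumping particle itself, which belonged to the stack that it left.\<close>

lemma sum_incoming:
  fixes f :: "int list \<Rightarrow> real"
  assumes X: "X \<in> configs n" and f: "\<And>x. x \<notin> level n k \<Longrightarrow> f x = 0"
  shows "(\<Sum>x\<in>level n k. tazrp_rate q a x X * f x) =
    (\<Sum>j | bottom_of_stack X j. a (X ! j - 1) * (1 - q ^ Suc (count_list X (X ! j - 1))) * f (X[j := X ! j - 1]))"
proof -
  define I where "I = (\<lambda>j. X[j := X ! j - 1]) ` {j. bottom_of_stack X j}"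
  have fin: "finite I" by (simp add: I_def)
  have "(\<Sum>x\<in>level n k. tazrp_rate q a x X * f x) = (\<Sum>x\<in>I. tazrp_rate q a x X * f x)"
  proof (rule sum.mono_neutral_cong[OF fin finite_level])
    show "tazrp_rate q a x X * f x = 0" if "x \<in> level n k - I" for x
    proof (rule ccontr)
      assume "tazrp_rate q a x X * f x \<noteq> 0"
      then obtain j where j: "top_of_stack x j" "X = x[j := x ! j + 1]"
        by (auto elim: tazrp_rate_nonzero)
      have x: "x \<in> configs n" "length x = n" using that by (auto simp: level_def configs_def)
      have jn: "j < n" using j x by (simp add: top_of_stack_def)
      then have "x = X[j := X ! j - 1]" using j x by simp
      moreover have "x ! Suc j \<le> x ! j" if "Suc j < n"
        using that by (intro configs_nth_mono[OF x(1)]) auto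
      then have "bottom_of_stack X j"
        using jn x(2) by (cases "Suc j = n") (auto simp: bottom_of_stack_def j(2))
      ultimately show False using that by (auto simp: I_def)
    qed
  qed (use f in auto)
  also have "\<dots> = (\<Sum>j | bottom_of_stack X j. tazrp_rate q a (X[j := X ! j - 1]) X * f (X[j := X ! j - 1]))"
    unfolding I_def
  proof (subst sum.reindex)
    show "inj_on (\<lambda>j. X[j := X ! j - 1]) {j. bottom_of_stack X j}"
      using list_update_add_inject[of X _ "-1"] by (intro inj_onI) (simp add: bottom_of_stack_def)
  qed simp
  also have "\<dots> = (\<Sum>j | bottom_of_stack X j. a (X ! j - 1) * (1 - q ^ Suc (count_list X (X ! j - 1))) * f (X[j := X ! j - 1]))"
  proof (intro sum.cong refl)
    fix j assume "j \<in> {j. bottom_of_stack X j}"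
    then have j: "bottom_of_stack X j" "j < length X" by (auto simp: bottom_of_stack_def)
    let ?Y = "X[j := X ! j - 1]"
    have "?Y[j := ?Y ! j + 1] = X" "?Y ! j = X ! j - 1" using j by simp_all
    then have "tazrp_rate q a ?Y X = a (X ! j - 1) * (1 - q ^ count_list ?Y (X ! j - 1))"
      using tazrp_rate_step[OF configs_step_down(2)[OF X j(1)], of q a] by simp
    moreover have "count_list ?Y (X ! j - 1) = Suc (count_list X (X ! j - 1))"
      using count_list_update[OF j(2), of "X ! j - 1" "X ! j - 1"] by simp
    ultimately show "tazrp_rate q a ?Y X * f ?Y =
        a (X ! j - 1) * (1 - q ^ Suc (count_list X (X ! j - 1))) * f ?Y" by simp
  qed
  finally show ?thesis .
qed


section \<open>The transition probabilities\<close>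

text \<open>The integrating factor \<open>exp (l * t)\<close> makes the product constant.\<close>

lemma linear_ode_zero:
  fixes D :: "real \<Rightarrow> complex"
  assumes T: "0 \<le> T" and D0: "D 0 = 0"
    and D: "\<And>t. t \<in> {0..T} \<Longrightarrow> (D has_vector_derivative - (of_real l * D t)) (at t within {0..T})"
  shows "D T = 0"
proof -
  have "((\<lambda>t. exp (of_real (l * t)) * D t) has_vector_derivative 0) (at t within {0..T})" if t: "t \<in> {0..T}" for t
  proof -
    have "((\<lambda>t. exp (of_real (l * t)) :: complex) has_vector_derivative of_real l * exp (of_real (l * t))) (at t within {0..T})"
      by (rule has_vector_derivative_eq_rhs, rule field_vector_diff_chain_within
          [where f = "\<lambda>t. of_real (l * t)" and g = exp, unfolded o_def])
        (auto intro!: derivative_eq_intros simp: scaleR_conv_of_real)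
    from has_vector_derivative_mult[OF this D[OF t]] show ?thesis by (simp add: algebra_simps)
  qed
  then obtain c where "\<And>t. t \<in> {0..T} \<Longrightarrow> exp (of_real (l * t)) * D t = c"
    using has_vector_derivative_zero_constant[of "{0..T}" "\<lambda>t. exp (of_real (l * t)) * D t"] by auto
  from this[of 0] this[of T] show ?thesis using T D0 by simp
qed

context bethe_ansatz
begin

text \<open>The right-hand side of the formula, with the powers of \<open>2 * pi * \<i>\<close>
  cancelled and the factors \<open>-1 / b\<close> moved into \<open>psi\<close>.\<close>

definition bethe_sum :: "int list \<Rightarrow> real \<Rightarrow> complex" where
  "bethe_sum X t = of_real (q_fact q (length X) / stack_weight q X) * wave X (of_real t) (\<lambda>_. 1)"

text \<open>\<open>sum_over_stacks\<close> collapses the free jumps to one term per bottom particle,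
  \<open>wave_coord\<close> splits it into gain and loss, and \<open>stack_weight_move\<close> gives
  the gain the rate of the stack that was left.\<close>

lemma bethe_sum_derivative:
  assumes sorted: "sorted_wrt (\<ge>) X" and enc: "\<And>x. x \<in> set X \<Longrightarrow> enclosed x"
  shows "(bethe_sum X has_vector_derivative
    (\<Sum>j | bottom_of_stack X j. of_real (b (X ! j - 1) * q_int q (Suc (count_list X (X ! j - 1)))) * bethe_sum (X[j := X ! j - 1]) t)
    - of_real (\<Sum>j | bottom_of_stack X j. b (X ! j) * q_int q (count_list X (X ! j))) * bethe_sum X t)
    (at t within A)"
proof -
  let ?N = "q_fact q (length X)" and ?W = "stack_weight q X" and ?B = "{j. bottom_of_stack X j}"
  let ?v = "wave X (of_real t) (\<lambda>_. 1)"
  have W: "stack_weight q x \<noteq> 0" for x using stack_weight_pos[OF q_pos q_less, of x] by simp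
  have "((\<lambda>s. of_real (?N / ?W) * wave X s (\<lambda>_. 1)) has_field_derivative
      of_real (?N / ?W) * - (\<Sum>l<length X. wave X (of_real t) (\<lambda>w. w l))) (at (of_real t))"
    by (intro DERIV_cmult wave_derivative enc)
  from has_vector_derivative_real_field[OF this]
  have "(bethe_sum X has_vector_derivative
      of_real (?N / ?W) * - (\<Sum>l<length X. wave X (of_real t) (\<lambda>w. w l))) (at t within A)"
    unfolding bethe_sum_def[abs_def] .
  also have "(\<Sum>l<length X. wave X (of_real t) (\<lambda>w. w l)) =
      (\<Sum>j\<in>?B. of_real (q_int q (count_list X (X ! j))) * wave X (of_real t) (\<lambda>w. w j))"
    using q_less by (intro sum_over_stacks sorted wave_exchange enc) auto
  also have "of_real (?N / ?W) * - \<dots> =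
      (\<Sum>j\<in>?B. - (of_real (?N / ?W) * (of_real (q_int q (count_list X (X ! j))) * wave X (of_real t) (\<lambda>w. w j))))"
    by (simp add: sum_distrib_left sum_negf)
  also have "\<dots> = (\<Sum>j\<in>?B. of_real (b (X ! j - 1) * q_int q (Suc (count_list X (X ! j - 1)))) * bethe_sum (X[j := X ! j - 1]) t
      - of_real (b (X ! j) * q_int q (count_list X (X ! j))) * bethe_sum X t)"
  proof (intro sum.cong refl)
    fix j assume "j \<in> ?B"
    then have j: "j < length X" by (simp add: bottom_of_stack_def)
    let ?Y = "X[j := X ! j - 1]" and ?h = "q_int q (count_list X (X ! j))"
    let ?h' = "q_int q (Suc (count_list X (X ! j - 1)))"
    have "?N / ?W * ?h = ?h' * (?N / stack_weight q ?Y)"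
      using stack_weight_move[OF j, of q] W by (simp add: field_simps)
    then have key: "(of_real (?N / ?W) * of_real ?h :: complex) = of_real ?h' * of_real (?N / stack_weight q ?Y)"
      by (simp only: of_real_mult[symmetric])
    have "- (of_real (?N / ?W) * (of_real ?h * wave X (of_real t) (\<lambda>w. w j))) =
        of_real (b (X ! j - 1)) * (of_real (?N / ?W) * of_real ?h) * wave ?Y (of_real t) (\<lambda>_. 1)
        - of_real (b (X ! j)) * (of_real ?h * (of_real (?N / ?W) * ?v))"
      by (subst wave_coord[OF enc j]) (simp_all add: algebra_simps)
    also have "\<dots> = of_real (b (X ! j - 1) * ?h') * bethe_sum ?Y t - of_real (b (X ! j) * ?h) * bethe_sum X t"
      unfolding key by (simp add: bethe_sum_def mult_ac)
    finally show "- (of_real (?N / ?W) * (of_real ?h * wave X (of_real t) (\<lambda>w. w j))) =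
        of_real (b (X ! j - 1) * ?h') * bethe_sum ?Y t - of_real (b (X ! j) * ?h) * bethe_sum X t" .
  qed
  finally show ?thesis by (simp add: sum_subtractf sum_distrib_right)
qed

lemma bethe_sum_negative:
  assumes "X \<in> configs n" "\<And>x. x \<in> set X \<Longrightarrow> enclosed x" "x \<in> set X" "x < 0"
  shows "bethe_sum X t = 0"
proof -
  obtain i where i: "i < length X" "X ! i = x" using assms(3) by (auto simp: in_set_conv_nth)
  have n: "length X = n" using assms(1) by (simp add: configs_def)
  then have "X ! (n - 1) \<le> X ! i" using i by (intro configs_nth_mono[OF assms(1)]) auto
  moreover have "X \<noteq> []" using i by auto
  ultimately have X: "X \<noteq> []" "last X \<le> X ! i" using n by (simp_all add: last_conv_nth)
  have "last X < 0" using X(2) i(2) assms(4) by linarith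
  with assms(2) X(1) have "wave X (of_real t) (\<lambda>_. 1) = 0" by (rule wave_negative)
  then show ?thesis by (simp only: bethe_sum_def mult_zero_right)
qed

text \<open>A state of a level other than the origin has a positive largest entry. It stands first,
  which is why the first variable is the one to integrate.\<close>

lemma bethe_sum_initial:
  assumes X: "X \<in> level n k" and n: "1 \<le> n" and enc: "\<And>x. x \<in> set X \<Longrightarrow> enclosed x"
  shows "bethe_sum X 0 = (if X = replicate n 0 then 1 else 0)"
proof (cases "X = replicate n 0")
  case True
  have "enclosed 0" using n by (intro enc) (simp add: True)
  moreover have "stack_weight q X = q_fact q n" "0 < q_fact q n"
    using n q_fact_pos[OF q_pos q_less, of n] by (simp_all add: True stack_weight_def count_list_eq_length_filter)
  ultimately show ?thesis by (simp add: True bethe_sum_def wave_origin)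
next
  case False
  have len: "length X = n" using X by (simp add: level_def configs_def)
  obtain i where i: "i < n" "X ! i \<noteq> 0"
    using False len nth_equalityI[of X "replicate n 0"] by auto
  have "X ! i \<le> X ! 0" using X i by (intro configs_nth_mono[of X n]) (auto simp: level_def)
  moreover have "0 \<le> X ! i" using X i len by (auto simp: level_def)
  ultimately have "0 < X ! 0" using i by simp
  moreover have "X \<noteq> []" using n len by auto
  ultimately have "wave X 0 (\<lambda>_. 1) = 0" by (intro wave_initial_zero[OF enc])
  then show ?thesis using False by (simp add: bethe_sum_def)
qed

end

text \<open>The induction includes states with negative entries: they occur as formal predecessors,
  and both sides vanish on them. On the nonnegative states the inflows agree by the induction
  hypothesis, so the difference solves a homogeneous linear equation with initial value 0.\<close>

theorem (in bethe_ansatz) occupied_eq_bethe_sum: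
  assumes n: "1 \<le> n" and b_eq: "\<And>i. b i = a i * (1 - q)"
    and chain: "leveled_jump_chain M (tazrp_rate q a) (replicate n 0) Z S (level n)"
    and "X \<in> configs n" "\<And>x. x \<in> set X \<Longrightarrow> enclosed x" "sum_list X = int k" "0 \<le> T"
  shows "of_real (leveled_jump_chain.occupied M Z S k X T) = bethe_sum X T"
  using assms(4-)
proof (induction k arbitrary: X T rule: less_induct)
  case (less k)
  interpret leveled_jump_chain M "tazrp_rate q a" "replicate n 0" Z S "level n" by (rule chain)
  note X = less.prems(1) and enc = less.prems(2) and sum = less.prems(3) and T = less.prems(4)
  let ?B = "{j. bottom_of_stack X j}"
  let ?Y = "\<lambda>j. X[j := X ! j - 1]"
  let ?in = "\<lambda>j. b (X ! j - 1) * q_int q (Suc (count_list X (X ! j - 1)))"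
  have sorted: "sorted_wrt (\<ge>) X" using X by (simp add: configs_def)
  show ?case
  proof (cases "\<exists>x\<in>set X. x < 0")
    case True
    then have "X \<notin> level n k" by (auto simp: level_def not_le[symmetric])
    then show ?thesis using True bethe_sum_negative[OF X enc] by (auto simp: occupied_outside)
  next
    case False
    then have XL: "X \<in> level n k" using X sum by (auto simp: level_def not_less)
    define l where "l = total_rate (tazrp_rate q a) X"
    define D where "D t = of_real (occupied k X t) - bethe_sum X t" for t
    have l: "l = (\<Sum>j\<in>?B. b (X ! j) * q_int q (count_list X (X ! j)))"
      unfolding l_def using q_less by (subst total_rate_bottom[OF XL]) (auto simp: b_eq)
    have enc_Y: "enclosed x" if "j \<in> ?B" "x \<in> set (?Y j)" for j x
    proof -
      have "j < length X" using that by (simp add: bottom_of_stack_def)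
      then have "enclosed (X ! j - 1)" by (intro enclosed_mono[OF enc[OF nth_mem]]) auto
      then show ?thesis using that set_update_subset_insert[of X j "X ! j - 1"] enc by blast
    qed
    have Y: "?Y j \<in> configs n" "sum_list (?Y j) = int k - 1" if "j \<in> ?B" for j
      using that configs_step_down(1)[OF X] sum by (auto simp: sum_list_int_update bottom_of_stack_def)
    have inflow: "of_real (case k of 0 \<Rightarrow> 0 | Suc j \<Rightarrow> \<Sum>x\<in>level n j. tazrp_rate q a x X * occupied j x t) =
        (\<Sum>j\<in>?B. of_real (?in j) * bethe_sum (?Y j) t)" if t: "0 \<le> t" for t
    proof (cases k)
      case 0
      \<comment> \<open>The formal predecessors of the origin have sum -1 and hence a negative
        entry.\<close>
      have "bethe_sum (?Y j) t = 0" if j: "j \<in> ?B" for j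
      proof -
        have "\<exists>x\<in>set (?Y j). x < 0"
        proof (rule ccontr)
          assume "\<not> ?thesis"
          then have "0 \<le> sum_list (?Y j)" by (intro sum_list_nonneg) (auto simp: not_less)
          then show False using Y(2)[OF j] 0 by simp
        qed
        then show ?thesis using bethe_sum_negative[OF Y(1)[OF j] enc_Y[OF j]] by blast
      qed
      then show ?thesis using 0 by simp
    next
      case (Suc i)
      have "of_real (\<Sum>x\<in>level n i. tazrp_rate q a x X * occupied i x t) =
          (\<Sum>j\<in>?B. complex_of_real (a (X ! j - 1) * (1 - q ^ Suc (count_list X (X ! j - 1)))) * of_real (occupied i (?Y j) t))"
        by (subst sum_incoming[OF X occupied_outside]) simp_all
      also have "\<dots> = (\<Sum>j\<in>?B. of_real (?in j) * bethe_sum (?Y j) t)"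
      proof (intro sum.cong refl arg_cong2[where f = "(*)"])
        fix j assume j: "j \<in> ?B"
        show "complex_of_real (a (X ! j - 1) * (1 - q ^ Suc (count_list X (X ! j - 1)))) = of_real (?in j)"
          using q_less by (simp add: b_eq q_int_def)
        show "of_real (occupied i (?Y j) t) = bethe_sum (?Y j) t"
          using Suc Y[OF j] t by (intro less.IH) (auto intro: enc_Y[OF j])
      qed
      finally show ?thesis by (simp add: Suc)
    qed
    have "D T = 0"
    proof (rule linear_ode_zero[OF T])
      have "X = replicate n 0 \<Longrightarrow> k = 0" using sum by (simp add: sum_list_replicate)
      then show "D 0 = 0"
        using bethe_sum_initial[OF XL n enc] by (auto simp: D_def occupied_start)
      fix t assume t: "t \<in> {0..T}"
      have "((\<lambda>t. of_real (occupied k X t) - bethe_sum X t) has_vector_derivative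
          of_real ((case k of 0 \<Rightarrow> 0 | Suc j \<Rightarrow> \<Sum>x\<in>level n j. tazrp_rate q a x X * occupied j x t) - l * occupied k X t) -
          ((\<Sum>j\<in>?B. of_real (?in j) * bethe_sum (?Y j) t) - of_real l * bethe_sum X t)) (at t within {0..T})"
        using forward_equation[OF XL t] bethe_sum_derivative[OF sorted enc, of t "{0..T}"]
        unfolding l_def[symmetric] l[symmetric]
        by (intro has_vector_derivative_diff has_vector_derivative_of_real)
          (auto simp: has_real_derivative_iff_has_vector_derivative)
      then show "(D has_vector_derivative - (of_real l * D t)) (at t within {0..T})"
        using inflow[of t] t by (simp add: D_def[abs_def] algebra_simps)
    qed
    then show ?thesis by (simp add: D_def)
  qed
qed

lemma leveled_jump_chain_tazrp:
  assumes "1 \<le> n" "0 < q" "q < 1" "\<And>i. 0 < a i"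
    and "jump_chain M (tazrp_rate q a) (replicate n 0) Z S"
  shows "leveled_jump_chain M (tazrp_rate q a) (replicate n 0) Z S (level n)"
proof -
  interpret jump_chain M "tazrp_rate q a" "replicate n 0" Z S by fact
  show ?thesis
  proof
    show "0 \<le> tazrp_rate q a x x'" for x x' by (rule tazrp_rate_nonneg) fact+
    show "finite (level n k)" for k by (rule finite_level)
    show "level n 0 = {replicate n 0}" by (rule level_0)
    fix k x assume x: "x \<in> level n k"
    show "0 < total_rate (tazrp_rate q a) x" by (rule total_rate_level_pos[OF x]) fact+
    show "(\<Sum>x'\<in>level n (Suc k). tazrp_rate q a x x') = total_rate (tazrp_rate q a) x"
      by (rule total_rate_level[OF x, symmetric])
  qed
qed

text \<open>Bookkeeping of factors: each \<open>-1 / b\<close> completes a primed product to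
  \<open>psi\<close>, each \<open>w j\<close> comes from \<open>dw\<close>, and the powers of
  \<open>2 * pi * \<i>\<close> cancel.\<close>

lemma (in bethe_ansatz) iterated_contour_integral_eq_bethe_sum:
  assumes X: "length X = n" and enc: "\<And>x. x \<in> set X \<Longrightarrow> enclosed x"
  shows "of_real (q_fact q n) * (1 / of_real (stack_weight q X))
    * (\<Prod>k<n. - 1 / of_real (b (X ! k)))
    * (1 / (2 * of_real pi * \<i>) ^ n)
    * iterated_contour_integral (circlepath 0 R) n
        (\<lambda>w. bethe_factor q w *
          (\<Prod>j<n. primed_prod 0 (X ! j) (\<lambda>k. of_real (b k) / (of_real (b k) - w ! j))
                  * exp (- (w ! j) * of_real t))) = bethe_sum X t"
proof -
  let ?F = "\<lambda>w. bethe_factor q w *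
    (\<Prod>j<n. primed_prod 0 (X ! j) (\<lambda>k. of_real (b k) / (of_real (b k) - w ! j)) * exp (- (w ! j) * of_real t))"
  let ?P = "\<Prod>k<n. - 1 / of_real (b (X ! k)) :: complex"
  let ?G = "\<lambda>w. bethe q n w * (\<Prod>j<n. (- of_real (b (X ! j)) * psi (X ! j) (w j)) * exp (- of_real t * w j))"
  have b: "of_real (b x) \<noteq> (0::complex)" for x using b_pos[of x] by simp
  have F: "?F (map w [0..<n]) = ?G w" for w
  proof -
    have "primed_prod 0 x (\<lambda>k. of_real (b k) / (of_real (b k) - u)) = - of_real (b x) * psi x u" for x u
      using b[of x] by (simp add: psi_def)
    then show ?thesis by (simp add: bethe_factor_map mult.commute)
  qed
  have G: "bdd_meas R n ?G"
    by (intro bdd_meas_mult bdd_meas_bethe bdd_meas_prod bdd_meas_exp bdd_meas_const bdd_meas_psi bdd_meas_coord)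
      (use X enc in auto)
  have integrand: "?P * (?G w * (\<Prod>j<n. w j)) = 1 * amplitude X w * exp (- of_real t * (\<Sum>j<length X. w j))" for w
  proof -
    let ?p = "\<Prod>j<n. psi (X ! j) (w j)" and ?c = "\<Prod>j<n. - of_real (b (X ! j)) * psi (X ! j) (w j)"
      and ?e = "\<Prod>j<n. exp (- of_real t * w j)"
    have p: "?P * ?c = ?p"
      unfolding prod.distrib[symmetric] using b by (intro prod.cong) auto
    have e: "exp (- of_real t * (\<Sum>j<n. w j)) = ?e"
      by (simp only: sum_distrib_left) (rule exp_sum, simp)
    have "?P * (?G w * (\<Prod>j<n. w j)) = (?P * ?c) * (bethe q n w * ?e * (\<Prod>j<n. w j))"
    proof -
      have "?G w = bethe q n w * (?c * ?e)" by (subst prod.distrib) (rule refl)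
      then show ?thesis by (simp only: mult_ac)
    qed
    also have "\<dots> = 1 * (bethe q n w * (\<Prod>j<n. psi (X ! j) (w j) * w j)) * ?e"
      unfolding p by (simp only: prod.distrib mult_1 mult_ac)
    finally show ?thesis by (simp only: amplitude_def X e)
  qed
  have wave_eq: "?P * (\<integral>w. ?G w * (\<Prod>j<n. w j) \<partial>torus R n) = wave X (of_real t) (\<lambda>_. 1)"
    unfolding wave_def by (subst integral_mult_right_zero[symmetric]) (simp only: integrand X)
  have "bdd_meas R n (\<lambda>w. ?F (map w [0..<n]))" unfolding F by (rule G)
  from iterated_contour_integral_torus[OF R_pos this]
  have iter: "iterated_contour_integral (circlepath 0 R) n ?F =
      (2 * of_real pi * \<i>) ^ n * (\<integral>w. ?G w * (\<Prod>j<n. w j) \<partial>torus R n)"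
    by (simp only: F of_real_mult of_real_numeral)
  have "u * (1 / v) * p * (1 / d) * (d * i) = u / v * (p * i)" if "d \<noteq> 0" for u v p d i :: complex
    using that by simp
  moreover have "(2 * of_real pi * \<i>) ^ n \<noteq> 0" by simp
  ultimately show ?thesis
    unfolding iter bethe_sum_def X wave_eq[symmetric] of_real_divide by blast
qed

theorem corollary1p3:
  fixes n :: nat and q R t :: real and a b :: "int \<Rightarrow> real" and X :: "int list"
    and M :: "'w measure" and Z :: "nat \<Rightarrow> 'w \<Rightarrow> int list" and S :: "nat \<Rightarrow> 'w \<Rightarrow> real"
  assumes "1 \<le> n" and "0 < q" and "q < 1"
    and "\<And>i. 0 < a i" and "\<And>i. b i = a i * (1 - q)"
    and "jump_chain M (tazrp_rate q a) (replicate n 0) Z S"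
    and "X \<in> configs n" and "0 < t"
    and "0 < R" and "\<And>x k. x \<in> set X \<Longrightarrow> 0 \<le> k \<Longrightarrow> k \<le> x \<Longrightarrow> b k < R"
  shows "complex_of_real \<P>(\<omega> in M. minimal_process Z S t \<omega> = Some X) =
    of_real (q_fact q n) * (1 / of_real (stack_weight q X))
    * (\<Prod>k<n. - 1 / of_real (b (X ! k)))
    * (1 / (2 * of_real pi * \<i>) ^ n)
    * iterated_contour_integral (circlepath 0 R) n
        (\<lambda>w. bethe_factor q w *
          (\<Prod>j<n. primed_prod 0 (X ! j) (\<lambda>k. of_real (b k) / (of_real (b k) - w ! j))
                  * exp (- (w ! j) * of_real t)))"
proof -
  have chain: "leveled_jump_chain M (tazrp_rate q a) (replicate n 0) Z S (level n)"
    by (rule leveled_jump_chain_tazrp) fact+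
  interpret leveled_jump_chain M "tazrp_rate q a" "replicate n 0" Z S "level n" by (rule chain)
  interpret bethe_ansatz q R b
    using assms(2-5,9) by unfold_locales auto
  have enc: "enclosed x" if "x \<in> set X" for x
    using assms(10) that by (auto simp: enclosed_def)
  \<comment> \<open>For a negative sum this is the default value 0; then \<open>X\<close> lies in no
    level, and both sides vanish.\<close>
  define k where "k = nat (sum_list X)"
  have "X \<notin> level n j" if "j \<noteq> k" for j using that by (auto simp: level_def k_def)
  then have "\<P>(\<omega> in M. minimal_process Z S t \<omega> = Some X) = occupied k X t"
    using assms(8) by (intro prob_minimal_process) auto
  moreover have "of_real (occupied k X t) = bethe_sum X t"
  proof (cases "0 \<le> sum_list X")
    case True
    then show ?thesis
      using assms enc by (intro occupied_eq_bethe_sum[OF _ _ chain]) (auto simp: k_def)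
  next
    case False
    then have neg: "\<exists>x\<in>set X. x < 0" using sum_list_nonneg[of X] by (auto simp: not_less[symmetric])
    then have "X \<notin> level n k" by (auto simp: level_def not_le[symmetric])
    then show ?thesis using neg bethe_sum_negative[OF assms(7) enc] by (auto simp: occupied_outside)
  qed
  moreover have "length X = n" using assms(7) by (simp add: configs_def)
  ultimately show ?thesis
    using iterated_contour_integral_eq_bethe_sum[of X n t, OF _ enc] by (simp only:)
qed

end
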